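(* Let $\mathcal{X}\subseteq\mathbb{R}^d$, let $P,Q\in\mathcal{P}(\mathcal{X})$, and let $(X_t)_{t\ge 1}$ and $(Y_s)_{s\ge 1}$ be independent sequences of i.i.d. observations from $P$ and $Q$ respectively, with empirical measures $P_t=\frac1t\sum_{i=1}^t\delta_{X_i}$ and $Q_s=\frac1s\sum_{j=1}^s\delta_{Y_j}$. Let $\Phi:\mathcal{P}(\mathcal{X})\to\mathbb{R}\cup\{\infty\}$ and $\Psi:\mathcal{P}(\mathcal{X})\times\mathcal{P}(\mathcal{X})\to\mathbb{R}\cup\{\infty\}$ be convex functionals such that $\Phi(P_t),\Psi(P_t,Q_s)\in L^1(\mathbb{P})$ for all $t,s\ge 1$. Then: (i) $(\Phi(P_t))_{t\ge1}$ is a reverse submartingale with respect to $(\mathcal{E}^X_t)_{t\ge 1}$. (ii) $(\Psi(P_t,Q_s))_{t,s\ge1}$ is a partially ordered reverse submartingale with respect to $(\mathcal{E}_{ts})_{t,s\ge 1}$, where $\mathcal{E}_{ts}=\sigma(\mathcal{E}_t^X\cup\mathcal{E}_s^Y)$.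
   Context: All random variables live on a probability space $(\Omega,\mathcal{F},\mathbb{P})$. $\mathcal{P}(\mathcal{X})$ is the set of Borel probability measures on $\mathcal{X}$, and $\delta_x$ is the Dirac measure at $x$. Convexity: $\Phi(\lambda\mu_1+(1-\lambda)\mu_2)\le\lambda\Phi(\mu_1)+(1-\lambda)\Phi(\mu_2)$ for all $\lambda\in[0,1]$ and $\mu_1,\mu_2\in\mathcal{P}(\mathcal{X})$; and $\Psi$ is jointly convex: $\Psi(\lambda\mu_1+(1-\lambda)\mu_2,\lambda\nu_1+(1-\lambda)\nu_2)\le\lambda\Psi(\mu_1,\nu_1)+(1-\lambda)\Psi(\mu_2,\nu_2)$. Exchangeable filtration: $\mathcal{E}^X_t$ is the $\sigma$-algebra generated by all real-valued Borel-measurable functions of $X_1,X_2,\dots$ which are permutation-symmetric in their first $t$ arguments; $\mathcal{E}^Y_s$ is defined in the same way from $(Y_s)$. A reverse filtration $(\mathcal{F}_t)_{t\ge1}$ is a nonincreasing sequence of sub-$\sigma$-algebras of $\mathcal{F}$. A reverse submartingale with respect to it is an integrable process $(R_t)$ with $R_t$ $\mathcal{F}_t$-measurable and $\mathbb{E}[R_t\mid\mathcal{F}_{t+1}]\ge R_{t+1}$ a.s. for all $t\ge1$. On $\mathbb{N}^2$ write $(t,s)\le(t',s')$ if $t\le t'$ and $s\le s'$, and $(t,s)<(t',s')$ if moreover at least one inequality is strict. A reverse filtration indexed by $\mathbb{N}^2$ is a family $(\mathcal{F}_{ts})$ nonincreasing in this order; a partially ordered reverse submartingale is an integrable adapted process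 $(R_{ts})$ with $\mathbb{E}[R_{ts}\mid\mathcal{F}_{t's'}]\ge R_{t's'}$ a.s. for all $(t,s)<(t',s')$. Measurability convention: $\Phi(P_t)$ and $\Psi(P_t,Q_s)$ are assumed to be Borel-measurable functions of $(X_1,\dots,X_t)$ and $(X_1,\dots,X_t,Y_1,\dots,Y_s)$ respectively. *)

theory Defs
  imports "HOL-Probability.Probability" "HOL-Combinatorics.Permutations"
begin

section \<open>Probability measures on a subset of Euclidean space\<close>

text \<open>
  The set \<open>S\<close> is arbitrary (not necessarily Borel), so its Borel sets are the traces of the
  Borel sets of the ambient space, which is the Borel sigma-algebra of the subspace topology.
\<close>

abbreviation borel_of :: "'a::topological_space set \<Rightarrow> 'a measure" where
  "borel_of S \<equiv> restrict_space borel S"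

abbreviation prob_measures :: "'a::topological_space set \<Rightarrow> 'a measure set" where
  "prob_measures S \<equiv> space (prob_algebra (borel_of S))"

definition mixture :: "real \<Rightarrow> 'a measure \<Rightarrow> 'a measure \<Rightarrow> 'a measure" where
  "mixture l \<mu> \<nu> =
     measure_of (space \<mu>) (sets \<mu>) (\<lambda>A. ennreal l * emeasure \<mu> A + ennreal (1 - l) * emeasure \<nu> A)"

definition empirical_measure :: "'a measure \<Rightarrow> nat \<Rightarrow> (nat \<Rightarrow> 'a) \<Rightarrow> 'a measure" where
  "empirical_measure K t x =
     measure_of (space K) (sets K) (\<lambda>A. (\<Sum>i=1..t. emeasure (return K (x i)) A) / of_nat t)"

lemma sets_mixture [simp]: "sets (mixture l \<mu> \<nu>) = sets \<mu>"
  and space_mixture [simp]: "space (mixture l \<mu> \<nu>) = space \<mu>"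
  by (simp_all add: mixture_def)

lemma emeasure_mixture:
  assumes "sets \<nu> = sets \<mu>" "A \<in> sets \<mu>"
  shows "emeasure (mixture l \<mu> \<nu>) A = ennreal l * emeasure \<mu> A + ennreal (1 - l) * emeasure \<nu> A"
proof (rule emeasure_measure_of[OF mixture_def])
  show "sets \<mu> \<subseteq> Pow (space \<mu>)"
    by (rule sets.space_closed)
  show "A \<in> sets (mixture l \<mu> \<nu>)"
    using assms by simp
  show "positive (sets (mixture l \<mu> \<nu>)) (\<lambda>A. ennreal l * emeasure \<mu> A + ennreal (1 - l) * emeasure \<nu> A)"
    by (simp add: positive_def)
  show "countably_additive (sets (mixture l \<mu> \<nu>))
          (\<lambda>A. ennreal l * emeasure \<mu> A + ennreal (1 - l) * emeasure \<nu> A)"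
  proof (rule countably_additiveI)
    fix B :: "nat \<Rightarrow> 'a set"
    assume B: "range B \<subseteq> sets (mixture l \<mu> \<nu>)" "disjoint_family B"
    then have "(\<Sum>i. emeasure \<mu> (B i)) = emeasure \<mu> (\<Union>i. B i)"
      "(\<Sum>i. emeasure \<nu> (B i)) = emeasure \<nu> (\<Union>i. B i)"
      using assms by (auto intro!: suminf_emeasure)
    then show "(\<Sum>i. ennreal l * emeasure \<mu> (B i) + ennreal (1 - l) * emeasure \<nu> (B i)) =
        ennreal l * emeasure \<mu> (\<Union>i. B i) + ennreal (1 - l) * emeasure \<nu> (\<Union>i. B i)"
      by (simp add: suminf_add[symmetric])
  qed
qed

lemma mixture_in_prob_algebra:
  assumes "\<mu> \<in> space (prob_algebra K)" "\<nu> \<in> space (prob_algebra K)" "l \<in> {0..1}"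
  shows "mixture l \<mu> \<nu> \<in> space (prob_algebra K)"
proof -
  have sets: "sets \<mu> = sets K" "sets \<nu> = sets K" and prob: "prob_space \<mu>" "prob_space \<nu>"
    using assms by (auto simp: space_prob_algebra)
  have sp: "space \<nu> = space \<mu>"
    using sets sets_eq_imp_space_eq by metis
  have "emeasure (mixture l \<mu> \<nu>) (space \<mu>) = ennreal l + ennreal (1 - l)"
    using sets sp prob_space.emeasure_space_1[OF prob(1)] prob_space.emeasure_space_1[OF prob(2)]
    by (subst emeasure_mixture) auto
  also have "\<dots> = 1"
    using assms(3) by (simp flip: ennreal_plus)
  finally have "prob_space (mixture l \<mu> \<nu>)"
    by (intro prob_spaceI) simp
  then show ?thesis
    using sets by (simp add: space_prob_algebra)
qed

lemma sets_empirical_measure [simp]: "sets (empirical_measure K t x) = sets K"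
  and space_empirical_measure [simp]: "space (empirical_measure K t x) = space K"
  by (simp_all add: empirical_measure_def)

lemma emeasure_empirical_measure:
  assumes "A \<in> sets K"
  shows "emeasure (empirical_measure K t x) A = (\<Sum>i=1..t. indicator A (x i)) / of_nat t"
proof -
  have "emeasure (empirical_measure K t x) A = (\<Sum>i=1..t. emeasure (return K (x i)) A) / of_nat t"
  proof (rule emeasure_measure_of[OF empirical_measure_def])
    show "sets K \<subseteq> Pow (space K)"
      by (rule sets.space_closed)
    show "A \<in> sets (empirical_measure K t x)"
      using assms by simp
    show "positive (sets (empirical_measure K t x))
            (\<lambda>A. (\<Sum>i=1..t. emeasure (return K (x i)) A) / of_nat t)"
      by (simp add: positive_def)
    show "countably_additive (sets (empirical_measure K t x))
            (\<lambda>A. (\<Sum>i=1..t. emeasure (return K (x i)) A) / of_nat t)"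
    proof (rule countably_additiveI)
      fix B :: "nat \<Rightarrow> 'a set"
      assume B: "range B \<subseteq> sets (empirical_measure K t x)" "disjoint_family B"
      have "(\<Sum>j. \<Sum>i=1..t. emeasure (return K (x i)) (B j)) =
          (\<Sum>i=1..t. emeasure (return K (x i)) (\<Union>j. B j))"
        using B by (subst suminf_sum) (auto simp del: emeasure_return intro!: sum.cong suminf_emeasure)
      then show "(\<Sum>j. (\<Sum>i=1..t. emeasure (return K (x i)) (B j)) / of_nat t) =
          (\<Sum>i=1..t. emeasure (return K (x i)) (\<Union>j. B j)) / of_nat t"
        by (simp add: divide_ennreal_def ennreal_suminf_multc)
    qed
  qed
  then show ?thesis
    using assms by simp
qed

lemma empirical_measure_in_prob_algebra:
  assumes "t \<ge> 1" "\<And>i. i \<in> {1..t} \<Longrightarrow> x i \<in> space K"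
  shows "empirical_measure K t x \<in> space (prob_algebra K)"
proof -
  have "emeasure (empirical_measure K t x) (space K) = (\<Sum>i=1..t. 1) / of_nat t"
    using assms(2) by (subst emeasure_empirical_measure) (auto intro!: arg_cong2[where f="(/)"] sum.cong)
  also have "\<dots> = 1"
    using assms(1) by (simp add: ennreal_divide_self ennreal_of_nat_eq_real_of_nat)
  finally have "prob_space (empirical_measure K t x)"
    by (intro prob_spaceI) simp
  then show ?thesis
    by (simp add: space_prob_algebra)
qed

section \<open>Convex functionals with values in the reals extended by infinity\<close>

text \<open>
  Since \<open>-\<infinity>\<close> is excluded, the right-hand sides are never of the form \<open>\<infinity> - \<infinity>\<close>; for
  \<open>l \<in> {0, 1}\<close> the convention \<open>0 * \<infinity> = 0\<close> of \<^typ>\<open>ereal\<close> applies and the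
  inequality is trivial.
\<close>

definition convex_functional :: "'a::topological_space set \<Rightarrow> ('a measure \<Rightarrow> ereal) \<Rightarrow> bool" where
  "convex_functional S \<Phi> \<longleftrightarrow>
     (\<forall>\<mu>\<in>prob_measures S. \<Phi> \<mu> \<noteq> -\<infinity>) \<and>
     (\<forall>l\<in>{0..1}. \<forall>\<mu>1\<in>prob_measures S. \<forall>\<mu>2\<in>prob_measures S.
        \<Phi> (mixture l \<mu>1 \<mu>2) \<le> ereal l * \<Phi> \<mu>1 + ereal (1 - l) * \<Phi> \<mu>2)"

definition jointly_convex_functional ::
  "'a::topological_space set \<Rightarrow> ('a measure \<Rightarrow> 'a measure \<Rightarrow> ereal) \<Rightarrow> bool" where
  "jointly_convex_functional S \<Psi> \<longleftrightarrow>
     (\<forall>\<mu>\<in>prob_measures S. \<forall>\<nu>\<in>prob_measures S. \<Psi> \<mu> \<nu> \<noteq> -\<infinity>) \<and>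
     (\<forall>l\<in>{0..1}. \<forall>\<mu>1\<in>prob_measures S. \<forall>\<mu>2\<in>prob_measures S.
        \<forall>\<nu>1\<in>prob_measures S. \<forall>\<nu>2\<in>prob_measures S.
        \<Psi> (mixture l \<mu>1 \<mu>2) (mixture l \<nu>1 \<nu>2) \<le> ereal l * \<Psi> \<mu>1 \<nu>1 + ereal (1 - l) * \<Psi> \<mu>2 \<nu>2)"

section \<open>Integrable extended-real random variables\<close>

text \<open>
  An integrable \<open>f\<close> is almost surely finite, so \<^const>\<open>real_of_ereal\<close> (which sends
  \<open>\<plusminus>\<infinity>\<close> to \<open>0\<close>) changes it only on a null set, to which the conditional expectation
  is insensitive.
\<close>

definition integrable_ereal :: "'a measure \<Rightarrow> ('a \<Rightarrow> ereal) \<Rightarrow> bool" where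
  "integrable_ereal M f \<longleftrightarrow> f \<in> borel_measurable M \<and> (\<integral>\<^sup>+\<omega>. e2ennreal \<bar>f \<omega>\<bar> \<partial>M) < \<infinity>"

definition cond_exp_ereal :: "'a measure \<Rightarrow> 'a measure \<Rightarrow> ('a \<Rightarrow> ereal) \<Rightarrow> 'a \<Rightarrow> ereal" where
  "cond_exp_ereal M F f = (\<lambda>\<omega>. ereal (real_cond_exp M F (\<lambda>\<omega>. real_of_ereal (f \<omega>)) \<omega>))"

section \<open>Reverse submartingales\<close>

text \<open>All index sets start at 1; the values of the families at index 0 are irrelevant.\<close>

definition reverse_filtration :: "'a measure \<Rightarrow> (nat \<Rightarrow> 'a measure) \<Rightarrow> bool" where
  "reverse_filtration M F \<longleftrightarrow>
     (\<forall>t\<ge>1. subalgebra M (F t)) \<and>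
     (\<forall>t\<ge>1. \<forall>t'\<ge>t. sets (F t') \<subseteq> sets (F t))"

definition reverse_submartingale ::
  "'a measure \<Rightarrow> (nat \<Rightarrow> 'a measure) \<Rightarrow> (nat \<Rightarrow> 'a \<Rightarrow> ereal) \<Rightarrow> bool" where
  "reverse_submartingale M F R \<longleftrightarrow>
     reverse_filtration M F \<and>
     (\<forall>t\<ge>1. integrable_ereal M (R t)) \<and>
     (\<forall>t\<ge>1. R t \<in> borel_measurable (F t)) \<and>
     (\<forall>t\<ge>1. AE \<omega> in M. cond_exp_ereal M (F (t + 1)) (R t) \<omega> \<ge> R (t + 1) \<omega>)"

definition reverse_filtration2 :: "'a measure \<Rightarrow> (nat \<Rightarrow> nat \<Rightarrow> 'a measure) \<Rightarrow> bool" where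
  "reverse_filtration2 M F \<longleftrightarrow>
     (\<forall>t\<ge>1. \<forall>s\<ge>1. subalgebra M (F t s)) \<and>
     (\<forall>t\<ge>1. \<forall>s\<ge>1. \<forall>t'\<ge>t. \<forall>s'\<ge>s. sets (F t' s') \<subseteq> sets (F t s))"

definition partially_ordered_reverse_submartingale ::
  "'a measure \<Rightarrow> (nat \<Rightarrow> nat \<Rightarrow> 'a measure) \<Rightarrow> (nat \<Rightarrow> nat \<Rightarrow> 'a \<Rightarrow> ereal) \<Rightarrow> bool" where
  "partially_ordered_reverse_submartingale M F R \<longleftrightarrow>
     reverse_filtration2 M F \<and>
     (\<forall>t\<ge>1. \<forall>s\<ge>1. integrable_ereal M (R t s)) \<and>
     (\<forall>t\<ge>1. \<forall>s\<ge>1. R t s \<in> borel_measurable (F t s)) \<and>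
     (\<forall>t\<ge>1. \<forall>s\<ge>1. \<forall>t'\<ge>t. \<forall>s'\<ge>s. t < t' \<or> s < s' \<longrightarrow>
        (AE \<omega> in M. cond_exp_ereal M (F t' s') (R t s) \<omega> \<ge> R t' s' \<omega>))"

section \<open>The exchangeable filtration\<close>

definition symmetric_functions :: "'b measure \<Rightarrow> nat \<Rightarrow> ((nat \<Rightarrow> 'b) \<Rightarrow> real) set" where
  "symmetric_functions K t =
     {f \<in> borel_measurable (PiM {1..} (\<lambda>_. K)).
        \<forall>p. p permutes {1..t} \<longrightarrow> (\<forall>x\<in>space (PiM {1..} (\<lambda>_. K)). f (x \<circ> p) = f x)}"

definition sample_path :: "(nat \<Rightarrow> 'a \<Rightarrow> 'b) \<Rightarrow> 'a \<Rightarrow> nat \<Rightarrow> 'b" where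
  "sample_path X \<omega> = (\<lambda>i\<in>{1..}. X i \<omega>)"

definition exchangeable_filtration ::
  "'a measure \<Rightarrow> 'b measure \<Rightarrow> (nat \<Rightarrow> 'a \<Rightarrow> 'b) \<Rightarrow> nat \<Rightarrow> 'a measure" where
  "exchangeable_filtration M K X t =
     sigma (space M)
       {(\<lambda>\<omega>. f (sample_path X \<omega>)) -` B \<inter> space M | f B. f \<in> symmetric_functions K t \<and> B \<in> sets borel}"

section \<open>Independent identically distributed observations\<close>

definition iid_sequence :: "'a measure \<Rightarrow> 'b measure \<Rightarrow> (nat \<Rightarrow> 'a \<Rightarrow> 'b) \<Rightarrow> 'b measure \<Rightarrow> bool" where
  "iid_sequence M K X P \<longleftrightarrow>
     prob_space.indep_vars M (\<lambda>_. K) X {1..} \<and> (\<forall>i\<ge>1. distr M K (X i) = P)"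

definition independent_sequences ::
  "'a measure \<Rightarrow> 'b measure \<Rightarrow> (nat \<Rightarrow> 'a \<Rightarrow> 'b) \<Rightarrow> (nat \<Rightarrow> 'a \<Rightarrow> 'b) \<Rightarrow> bool" where
  "independent_sequences M K X Y \<longleftrightarrow>
     prob_space.indep_var M (PiM {1..} (\<lambda>_. K)) (sample_path X) (PiM {1..} (\<lambda>_. K)) (sample_path Y)"

end

theory Submission
  imports Defs
begin

text \<open>
  The mean of \<open>P\<^sub>t\<close> over all permutations of the first \<open>t' \<ge> t\<close> observations is \<open>P\<^bsub>t'\<^esub>\<close>,
  so Jensen's inequality bounds \<open>\<Phi>(P\<^bsub>t'\<^esub>)\<close> by the mean of the permuted values of
  \<open>\<Phi>(P\<^sub>t)\<close>. By exchangeability all of these have the same conditional expectation given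
  \<open>\<E>\<^bsub>t'\<^esub>\<close>. For two samples one averages over pairs of permutations. The adaptedness of
  \<open>\<Psi>(P\<^sub>t, Q\<^sub>s)\<close> needs in addition that a set invariant under separate permutations of the two
  samples lies in the product of the two invariant sigma-algebras; this is seen by averaging
  its indicator over the finite permutation group.
\<close>

declare One_nat_def [simp del]

section \<open>Sigma-algebras of invariant sets\<close>

text \<open>Wrapping the invariant sets in \<open>sigma\<close> gives a measure space for any family
  \<open>T\<close>. The wrapping adds no sets once every \<open>T i\<close> maps
  \<open>space N\<close> into itself, because the invariant sets are then closed under complements
  and countable unions.\<close>

definition invariant_algebra :: "'b measure \<Rightarrow> 'i set \<Rightarrow> ('i \<Rightarrow> 'b \<Rightarrow> 'b) \<Rightarrow> 'b measure" where
  "invariant_algebra N I T =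
     sigma (space N) {D \<in> sets N. \<forall>i\<in>I. \<forall>x\<in>space N. T i x \<in> D \<longleftrightarrow> x \<in> D}"

lemma space_invariant_algebra [simp]: "space (invariant_algebra N I T) = space N"
  unfolding invariant_algebra_def
  by (rule space_measure_of) (use sets.sets_into_space in blast)

lemma sets_invariant_algebra:
  assumes "\<And>i x. i \<in> I \<Longrightarrow> x \<in> space N \<Longrightarrow> T i x \<in> space N"
  shows "sets (invariant_algebra N I T) =
    {D \<in> sets N. \<forall>i\<in>I. \<forall>x\<in>space N. T i x \<in> D \<longleftrightarrow> x \<in> D}" (is "_ = ?C")
proof -
  have C: "?C \<subseteq> Pow (space N)"
    using sets.sets_into_space by blast
  have "sigma_algebra (space N) ?C"
    unfolding sigma_algebra_iff2
  proof (intro conjI C allI impI ballI)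
    fix A :: "nat \<Rightarrow> _" assume "range A \<subseteq> ?C"
    then have "A n \<in> ?C" for n
      by blast
    then show "\<Union> (range A) \<in> ?C"
      by auto
  qed (use assms in auto)
  then show ?thesis
    unfolding invariant_algebra_def using C
    by (simp add: sigma_algebra.sigma_sets_eq)
qed

lemma measurable_invariant_algebra:
  assumes T: "\<And>i x. i \<in> I \<Longrightarrow> x \<in> space N \<Longrightarrow> T i x \<in> space N"
    and f: "f \<in> measurable N L"
    and inv: "\<And>i x. i \<in> I \<Longrightarrow> x \<in> space N \<Longrightarrow> f (T i x) = f x"
  shows "f \<in> measurable (invariant_algebra N I T) L"
proof (rule measurableI)
  fix B assume "B \<in> sets L"
  then show "f -` B \<inter> space (invariant_algebra N I T) \<in> sets (invariant_algebra N I T)"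
    using f T inv by (auto simp: sets_invariant_algebra)
qed (use f in \<open>auto simp: measurable_space\<close>)

section \<open>Coordinate permutations and the exchangeable filtration\<close>

lemma measurable_permute_coordinates:
  assumes "p permutes U" "U \<subseteq> I"
  shows "(\<lambda>x. x \<circ> p) \<in> measurable (PiM I (\<lambda>_. K)) (PiM I (\<lambda>_. K))"
proof -
  have pI: "p i \<in> I \<longleftrightarrow> i \<in> I" for i
    using assms by (metis permutes_in_image permutes_not_in subsetD)
  \<comment> \<open>Points outside \<open>I\<close> stay outside under \<open>p\<close>, and every
    \<open>x\<close> in the product space is \<open>undefined\<close> there. So
    \<open>x \<circ> p\<close> agrees with this restricted map, whose measurability is checked
    coordinatewise.\<close>
  have "(\<lambda>x. \<lambda>i\<in>I. x (p i)) \<in> measurable (PiM I (\<lambda>_. K)) (PiM I (\<lambda>_. K))"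
    using pI by (intro measurable_restrict measurable_component_singleton) auto
  also have "?this \<longleftrightarrow> ?thesis"
  proof (intro measurable_cong ext)
    fix x i assume "x \<in> space (PiM I (\<lambda>_. K))"
    then show "(\<lambda>i\<in>I. x (p i)) i = (x \<circ> p) i"
      using pI[of i] PiE_arb[of x I _ "p i"] by (auto simp: space_PiM)
  qed
  finally show ?thesis .
qed

lemma permute_coordinates_in_space:
  assumes "p permutes {1..t::nat}" "x \<in> space (PiM {1..} (\<lambda>_. K))"
  shows "x \<circ> p \<in> space (PiM {1..} (\<lambda>_. K))"
  using measurable_space[OF measurable_permute_coordinates[OF assms(1)] assms(2)] by auto

abbreviation sequences :: "'b measure \<Rightarrow> (nat \<Rightarrow> 'b) measure" where
  "sequences K \<equiv> PiM {1..} (\<lambda>_. K)"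

abbreviation exchangeable_algebra :: "'b measure \<Rightarrow> nat \<Rightarrow> (nat \<Rightarrow> 'b) measure" where
  "exchangeable_algebra K t \<equiv>
     invariant_algebra (sequences K) {p. p permutes {1..t}} (\<lambda>p x. x \<circ> p)"

lemma sets_exchangeable_algebra:
  "sets (exchangeable_algebra K t) = {D \<in> sets (sequences K).
     \<forall>p. p permutes {1..t} \<longrightarrow> (\<forall>x\<in>space (sequences K). x \<circ> p \<in> D \<longleftrightarrow> x \<in> D)}"
  by (subst sets_invariant_algebra) (auto intro: permute_coordinates_in_space)

text \<open>For the converse inclusion, the level set of \<open>f\<close> through \<open>x\<close>
  is a preimage of the Borel set \<open>{f x}\<close>, hence an invariant set. It therefore contains
  \<open>x \<circ> p\<close>, which forces \<open>f (x \<circ> p) = f x\<close>.\<close>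

lemma symmetric_functions_eq:
  "symmetric_functions K t = borel_measurable (exchangeable_algebra K t)"
proof (intro equalityI subsetI)
  fix f assume "f \<in> symmetric_functions K t"
  then show "f \<in> borel_measurable (exchangeable_algebra K t)"
    unfolding symmetric_functions_def
    by (auto intro!: measurable_invariant_algebra permute_coordinates_in_space)
next
  fix f :: "_ \<Rightarrow> real" assume f: "f \<in> borel_measurable (exchangeable_algebra K t)"
  have "f \<in> borel_measurable (sequences K)"
    by (rule measurableI) (use measurable_sets[OF f] in \<open>auto simp: sets_exchangeable_algebra\<close>)
  moreover have "f (x \<circ> p) = f x" if p: "p permutes {1..t}" and x: "x \<in> space (sequences K)" for p x
  proof -
    have "f -` {f x} \<inter> space (sequences K) \<in> sets (exchangeable_algebra K t)"
      using measurable_sets[OF f, of "{f x}"] by simp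
    then show ?thesis
      using p x by (auto simp: sets_exchangeable_algebra)
  qed
  ultimately show "f \<in> symmetric_functions K t"
    by (auto simp: symmetric_functions_def)
qed

lemma space_exchangeable_filtration [simp]:
  "space (exchangeable_filtration M K X t) = space M"
  unfolding exchangeable_filtration_def by (rule space_measure_of) auto

text \<open>A symmetric function pulls Borel sets back to invariant sets, and an invariant set is
  the level set at 1 of its own symmetric indicator. So the generators are exactly the preimages of
  invariant sets, and the exchangeable filtration becomes a pullback along the sample path.\<close>

lemma sets_exchangeable_filtration:
  assumes X: "sample_path X \<in> measurable M (sequences K)"
  shows "sets (exchangeable_filtration M K X t) =
    sets (vimage_algebra (space M) (sample_path X) (exchangeable_algebra K t))"
proof -
  have "{(\<lambda>\<omega>. f (sample_path X \<omega>)) -` B \<inter> space M | f B. f \<in> symmetric_functions K t \<and> B \<in> sets borel}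
      = {sample_path X -` D \<inter> space M | D. D \<in> sets (exchangeable_algebra K t)}" (is "?L = ?R")
  proof (intro equalityI subsetI)
    fix A assume "A \<in> ?L"
    then obtain f and B :: "real set" where f: "f \<in> borel_measurable (exchangeable_algebra K t)" "B \<in> sets borel"
      and A: "A = (\<lambda>\<omega>. f (sample_path X \<omega>)) -` B \<inter> space M"
      unfolding symmetric_functions_eq by blast
    have "A = sample_path X -` (f -` B \<inter> space (sequences K)) \<inter> space M"
      using measurable_space[OF X] A by auto
    moreover have "f -` B \<inter> space (sequences K) \<in> sets (exchangeable_algebra K t)"
      using measurable_sets[OF f] by simp
    ultimately show "A \<in> ?R"
      by blast
  next
    fix A assume "A \<in> ?R"
    then obtain D where D: "D \<in> sets (exchangeable_algebra K t)" and A: "A = sample_path X -` D \<inter> space M"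
      by blast
    have "(indicator D :: _ \<Rightarrow> real) \<in> symmetric_functions K t"
      using D by (simp add: symmetric_functions_eq)
    moreover have "A = (\<lambda>\<omega>. indicator D (sample_path X \<omega>) :: real) -` {1} \<inter> space M"
      using A by (auto simp: indicator_def)
    moreover have "{1::real} \<in> sets borel"
      by simp
    ultimately show "A \<in> ?L"
      by blast
  qed
  moreover have "sets (exchangeable_filtration M K X t) = sigma_sets (space M) ?L"
    unfolding exchangeable_filtration_def by (rule sets_measure_of) auto
  ultimately show ?thesis
    by (simp add: sets_vimage_algebra)
qed

lemma sample_path_measurable_exchangeable:
  assumes X: "sample_path X \<in> measurable M (sequences K)"
  shows "sample_path X \<in> measurable (exchangeable_filtration M K X t) (exchangeable_algebra K t)"
proof -
  have "sample_path X \<in> measurable (vimage_algebra (space M) (sample_path X) (exchangeable_algebra K t))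
      (exchangeable_algebra K t)"
    using measurable_space[OF X] by (intro measurable_vimage_algebra1) auto
  then show ?thesis
    using measurable_cong_sets[OF sets_exchangeable_filtration[OF X] refl] by blast
qed

lemma subalgebra_exchangeable_filtration:
  assumes X: "sample_path X \<in> measurable M (sequences K)"
  shows "subalgebra M (exchangeable_filtration M K X t)"
  unfolding subalgebra_def
proof
  show "sets (exchangeable_filtration M K X t) \<subseteq> sets M"
    using X measurable_space[OF X]
    by (auto simp: sets_exchangeable_filtration[OF X] sets_vimage_algebra2 sets_exchangeable_algebra)
qed simp

text \<open>A permutation of the first \<open>t\<close> indices fixes the later ones and so also
  permutes the first \<open>t'\<close>. Invariance at \<open>t'\<close> is thus the stronger
  condition.\<close>

lemma exchangeable_filtration_antimono:
  assumes X: "sample_path X \<in> measurable M (sequences K)" and "t \<le> t'"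
  shows "sets (exchangeable_filtration M K X t') \<subseteq> sets (exchangeable_filtration M K X t)"
proof -
  have "p permutes {1..t'}" if "p permutes {1..t}" for p
    using that assms(2) by (auto intro: permutes_subset)
  then show ?thesis
    using measurable_space[OF X]
    by (auto simp: sets_exchangeable_filtration[OF X] sets_vimage_algebra2 sets_exchangeable_algebra)
qed

section \<open>Conditional expectations of means over law-preserving maps\<close>

lemma AE_finite_integrable_ereal:
  assumes "integrable_ereal M f"
  shows "AE \<omega> in M. \<bar>f \<omega>\<bar> \<noteq> \<infinity>"
proof -
  have "AE \<omega> in M. e2ennreal \<bar>f \<omega>\<bar> \<noteq> \<infinity>"
    using assms unfolding integrable_ereal_def
    by (intro nn_integral_PInf_AE) (auto simp: less_top)
  then show ?thesis
  proof eventually_elim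
    case (elim \<omega>)
    then show ?case
      by (cases "f \<omega>") auto
  qed
qed

lemma integrable_real_of_ereal:
  assumes "integrable_ereal M f"
  shows "integrable M (\<lambda>\<omega>. real_of_ereal (f \<omega>))"
proof -
  have [measurable]: "f \<in> borel_measurable M" and fin: "(\<integral>\<^sup>+\<omega>. e2ennreal \<bar>f \<omega>\<bar> \<partial>M) < \<infinity>"
    using assms by (auto simp: integrable_ereal_def)
  \<comment> \<open>At infinite \<open>x\<close> the left side is 0, the value of
    \<open>real_of_ereal\<close> there; at finite \<open>x\<close> both sides agree.\<close>
  have "ennreal \<bar>real_of_ereal x\<bar> \<le> e2ennreal \<bar>x\<bar>" for x
    by (cases x) (auto simp: e2ennreal_ereal)
  then have "(\<integral>\<^sup>+\<omega>. ennreal (norm (real_of_ereal (f \<omega>))) \<partial>M) \<le> (\<integral>\<^sup>+\<omega>. e2ennreal \<bar>f \<omega>\<bar> \<partial>M)"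
    by (intro nn_integral_mono) simp
  then show ?thesis
    using fin by (intro integrableI_bounded) auto
qed

text \<open>A set in \<open>F\<close> is the preimage under \<open>Z\<close> of an invariant set,
  and each \<open>T j\<close> preserves the law of \<open>Z\<close>; hence
  \<open>g (T j (Z \<omega>))\<close> and \<open>g (Z \<omega>)\<close> have the same integral over
  it. All these variables, and so their mean, share one conditional expectation given
  \<open>F\<close>. An \<open>F\<close>-measurable \<open>R\<close> below that mean is its own
  conditional expectation, and monotonicity concludes. In \<open>mean\<close> the values may be
  taken as finite, since almost surely they are.\<close>

lemma cond_exp_ge_of_invariant_mean:
  assumes "prob_space M"
    and Z [measurable]: "Z \<in> measurable M N"
    and J: "finite J" "J \<noteq> {}"
    and T [measurable]: "\<And>j. j \<in> J \<Longrightarrow> T j \<in> measurable N N"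
    and law: "\<And>j. j \<in> J \<Longrightarrow> distr (distr M N Z) N (T j) = distr M N Z"
    and F: "space F = space M" "sets F \<subseteq> sets (vimage_algebra (space M) Z (invariant_algebra N J T))"
    and g [measurable]: "g \<in> borel_measurable N" and int: "integrable_ereal M (\<lambda>\<omega>. g (Z \<omega>))"
    and R: "R \<in> borel_measurable F" "integrable_ereal M R"
    and mean: "\<And>\<omega>. \<omega> \<in> space M \<Longrightarrow> (\<And>j. j \<in> J \<Longrightarrow> \<bar>g (T j (Z \<omega>))\<bar> \<noteq> \<infinity>) \<Longrightarrow>
      R \<omega> \<le> ereal ((\<Sum>j\<in>J. real_of_ereal (g (T j (Z \<omega>)))) / card J)"
  shows "AE \<omega> in M. R \<omega> \<le> cond_exp_ereal M F (\<lambda>\<omega>. g (Z \<omega>)) \<omega>"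
proof -
  interpret prob_space M by fact
  have TN: "\<And>j x. j \<in> J \<Longrightarrow> x \<in> space N \<Longrightarrow> T j x \<in> space N"
    by (rule measurable_space[OF T])
  have ZN: "Z \<in> space M \<rightarrow> space (invariant_algebra N J T)"
    using measurable_space[OF Z] by auto
  have sets_F: "\<exists>D\<in>sets N. A = Z -` D \<inter> space M \<and> (\<forall>j\<in>J. \<forall>x\<in>space N. T j x \<in> D \<longleftrightarrow> x \<in> D)"
    if "A \<in> sets F" for A
  proof -
    have "A \<in> {Z -` D \<inter> space M | D. D \<in> sets (invariant_algebra N J T)}"
      using subsetD[OF F(2) that] by (simp only: sets_vimage_algebra2[OF ZN])
    then show ?thesis
      by (auto simp: sets_invariant_algebra[OF TN])
  qed
  have "A \<in> sets M" if A: "A \<in> sets F" for A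
    using sets_F[OF A] measurable_sets[OF Z] by auto
  then have sub: "subalgebra M F"
    using F(1) by (auto simp: subalgebra_def)
  interpret F: finite_measure_subalgebra M F
    by standard (rule sub)
  let ?L = "distr M N Z" and ?g = "\<lambda>x. real_of_ereal (g x)"
  let ?h = "\<lambda>\<omega>. (\<Sum>j\<in>J. ?g (T j (Z \<omega>))) / card J"
  have gZ: "integrable M (\<lambda>\<omega>. ?g (Z \<omega>))"
    by (rule integrable_real_of_ereal[OF int])
  then have gL: "integrable ?L ?g"
    by (simp add: integrable_distr_eq)
  have gT: "integrable M (\<lambda>\<omega>. ?g (T j (Z \<omega>)))" if j: "j \<in> J" for j
  proof -
    note [measurable] = T[OF j]
    have "integrable (distr ?L N (T j)) ?g"
      using gL law[OF j] by simp
    then show ?thesis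
      by (simp add: integrable_distr_eq)
  qed
  \<comment> \<open>Finiteness of \<open>g\<close> almost everywhere under the law of
    \<open>Z\<close> carries over to \<open>T j\<close>, because \<open>T j\<close> leaves that law
    unchanged.\<close>
  have fin: "AE \<omega> in M. \<bar>g (T j (Z \<omega>))\<bar> \<noteq> \<infinity>" if j: "j \<in> J" for j
  proof -
    note [measurable] = T[OF j]
    have "AE x in ?L. \<bar>g x\<bar> \<noteq> \<infinity>"
      using AE_finite_integrable_ereal[OF int] by (subst AE_distr_iff) auto
    then have "AE x in distr ?L N (T j). \<bar>g x\<bar> \<noteq> \<infinity>"
      unfolding law[OF j] .
    then show ?thesis
      by (simp add: AE_distr_iff)
  qed
  have set_int: "(\<integral>\<omega>\<in>A. ?g (T j (Z \<omega>)) \<partial>M) = (\<integral>\<omega>\<in>A. ?g (Z \<omega>) \<partial>M)" if A: "A \<in> sets F" and j: "j \<in> J" for A j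
  proof -
    note [measurable] = T[OF j]
    obtain D where [measurable]: "D \<in> sets N" and A: "A = Z -` D \<inter> space M"
      and D: "\<And>x. x \<in> space N \<Longrightarrow> T j x \<in> D \<longleftrightarrow> x \<in> D"
      using sets_F[OF A] j by blast
    \<comment> \<open>Invariance of \<open>D\<close> lets its indicator be evaluated at
      \<open>T j (Z \<omega>)\<close> as well. The whole integrand is then a function of
      \<open>T j (Z \<omega>)\<close>, so its integral is one against the image law.\<close>
    have "(\<integral>\<omega>\<in>A. ?g (T j (Z \<omega>)) \<partial>M) = (\<integral>\<omega>. indicator D (T j (Z \<omega>)) * ?g (T j (Z \<omega>)) \<partial>M)"
      unfolding set_lebesgue_integral_def using D measurable_space[OF Z]
      by (intro Bochner_Integration.integral_cong) (auto simp: A indicator_def)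
    also have "\<dots> = (\<integral>x. indicator D x * ?g x \<partial>(distr ?L N (T j)))"
      by (simp add: integral_distr)
    also have "\<dots> = (\<integral>\<omega>. indicator D (Z \<omega>) * ?g (Z \<omega>) \<partial>M)"
      unfolding law[OF j] by (simp add: integral_distr)
    also have "\<dots> = (\<integral>\<omega>\<in>A. ?g (Z \<omega>) \<partial>M)"
      unfolding set_lebesgue_integral_def
      by (intro Bochner_Integration.integral_cong) (auto simp: A indicator_def)
    finally show ?thesis .
  qed
  have h: "integrable M ?h"
    using gT by (intro integrable_divide Bochner_Integration.integrable_sum) auto
  \<comment> \<open>A conditional expectation is characterized by its integrals over the sets of
    \<open>F\<close>, and each of the \<open>card J\<close> terms of \<open>?h\<close> contributes
    the same integral.\<close>
  have mean_h: "AE \<omega> in M. real_cond_exp M F ?h \<omega> = real_cond_exp M F (\<lambda>\<omega>. ?g (Z \<omega>)) \<omega>"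
  proof (rule F.real_cond_exp_charact[OF _ h F.real_cond_exp_int(1)[OF gZ] borel_measurable_cond_exp])
    fix A assume A: "A \<in> sets F"
    then have AM: "A \<in> sets M"
      using sub by (auto simp: subalgebra_def)
    have "(\<integral>\<omega>\<in>A. ?h \<omega> \<partial>M) = (\<Sum>j\<in>J. \<integral>\<omega>\<in>A. ?g (T j (Z \<omega>)) \<partial>M) / card J"
      unfolding set_lebesgue_integral_def
      using gT integrable_mult_indicator[OF AM gT]
      by (simp add: sum_distrib_left Bochner_Integration.integral_sum)
    also have "\<dots> = (\<integral>\<omega>\<in>A. ?g (Z \<omega>) \<partial>M)"
      using J by (simp add: set_int[OF A])
    also have "\<dots> = (\<integral>\<omega>\<in>A. real_cond_exp M F (\<lambda>\<omega>. ?g (Z \<omega>)) \<omega> \<partial>M)"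
      by (rule F.real_cond_exp_intA[OF gZ A])
    finally show "(\<integral>\<omega>\<in>A. ?h \<omega> \<partial>M) = (\<integral>\<omega>\<in>A. real_cond_exp M F (\<lambda>\<omega>. ?g (Z \<omega>)) \<omega> \<partial>M)" .
  qed
  have "AE \<omega> in M. \<forall>j\<in>J. \<bar>g (T j (Z \<omega>))\<bar> \<noteq> \<infinity>"
    using fin J by (intro AE_finite_allI) auto
  \<comment> \<open>Outside a null set \<open>R\<close> and all the values of \<open>g\<close> are
    finite, so \<open>mean\<close> turns into an inequality of reals.\<close>
  then have "AE \<omega> in M. real_of_ereal (R \<omega>) \<le> ?h \<omega>"
    using AE_finite_integrable_ereal[OF R(2)] AE_space
  proof eventually_elim
    case (elim \<omega>)
    then show ?case
      using mean[of \<omega>] by (cases "R \<omega>") auto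
  qed
  then have "AE \<omega> in M. real_cond_exp M F (\<lambda>\<omega>. real_of_ereal (R \<omega>)) \<omega> \<le> real_cond_exp M F ?h \<omega>"
    by (rule F.real_cond_exp_mono[OF _ integrable_real_of_ereal[OF R(2)] h])
  moreover have "AE \<omega> in M. real_cond_exp M F (\<lambda>\<omega>. real_of_ereal (R \<omega>)) \<omega> = real_of_ereal (R \<omega>)"
    using R(1) by (intro F.real_cond_exp_F_meas integrable_real_of_ereal[OF R(2)]) auto
  ultimately show ?thesis
    using mean_h AE_finite_integrable_ereal[OF R(2)]
  proof eventually_elim
    case (elim \<omega>)
    then show ?case
      unfolding cond_exp_ereal_def by (cases "R \<omega>") auto
  qed
qed

section \<open>Sets invariant under separate permutations of two samples\<close>

abbreviation permute_pair :: "(nat \<Rightarrow> nat) \<times> (nat \<Rightarrow> nat) \<Rightarrow> (nat \<Rightarrow> 'b) \<times> (nat \<Rightarrow> 'c) \<Rightarrow> (nat \<Rightarrow> 'b) \<times> (nat \<Rightarrow> 'c)" where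
  "permute_pair \<equiv> \<lambda>(p, q) (x, y). (x \<circ> p, y \<circ> q)"

abbreviation pair_exchangeable_algebra ::
  "'b measure \<Rightarrow> 'c measure \<Rightarrow> nat \<Rightarrow> nat \<Rightarrow> ((nat \<Rightarrow> 'b) \<times> (nat \<Rightarrow> 'c)) measure" where
  "pair_exchangeable_algebra K L t s \<equiv> invariant_algebra (sequences K \<Otimes>\<^sub>M sequences L)
     ({p. p permutes {1..t}} \<times> {q. q permutes {1..s}}) permute_pair"

lemma sets_pair_exchangeable_algebra:
  "sets (pair_exchangeable_algebra K L t s) = {D \<in> sets (sequences K \<Otimes>\<^sub>M sequences L).
     \<forall>p q x y. p permutes {1..t} \<longrightarrow> q permutes {1..s} \<longrightarrow> x \<in> space (sequences K) \<longrightarrow>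
       y \<in> space (sequences L) \<longrightarrow> ((x \<circ> p, y \<circ> q) \<in> D \<longleftrightarrow> (x, y) \<in> D)}"
  by (subst sets_invariant_algebra)
    (auto simp: space_pair_measure intro: permute_coordinates_in_space)

text \<open>Replacing \<open>x\<close> by \<open>x \<circ> q\<close> only reorders the sum, because
  left composition with \<open>q\<close> is a bijection of the permutations of
  \<open>{1..t}\<close>.\<close>

lemma measurable_symmetrization:
  fixes f :: "_ \<Rightarrow> ennreal"
  assumes f: "f \<in> borel_measurable (sequences K)"
  shows "(\<lambda>x. \<Sum>p | p permutes {1..t}. f (x \<circ> p)) \<in> borel_measurable (exchangeable_algebra K t)"
proof (rule measurable_invariant_algebra)
  show "(\<lambda>x. \<Sum>p | p permutes {1..t}. f (x \<circ> p)) \<in> borel_measurable (sequences K)"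
  proof (rule borel_measurable_sum)
    fix p assume "p \<in> {p. p permutes {1..t}}"
    then show "(\<lambda>x. f (x \<circ> p)) \<in> borel_measurable (sequences K)"
      using measurable_compose[OF measurable_permute_coordinates f, of p "{1..t}"] by auto
  qed
next
  fix q x assume "q \<in> {p. p permutes {1..t}}"
  then show "(\<Sum>p | p permutes {1..t}. f (x \<circ> q \<circ> p)) = (\<Sum>p | p permutes {1..t}. f (x \<circ> p))"
    using setum_permutations_compose_left[of q "{1..t}" "\<lambda>p. f (x \<circ> p)"] by (simp add: o_assoc)
qed (auto intro: permute_coordinates_in_space)

text \<open>Invariance alone does not yet show measurability for a product of two sigma-algebras.
  The claim is proved by induction from rectangles over complements and disjoint unions, which works
  because the sum is additive in the indicator of \<open>E\<close>.\<close>

lemma measurable_pair_symmetrization: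
  assumes "E \<in> sets (sequences K \<Otimes>\<^sub>M sequences L)"
  shows "(\<lambda>(x, y). \<Sum>p | p permutes {1..t}. \<Sum>q | q permutes {1..s}. indicator E (x \<circ> p, y \<circ> q) :: ennreal)
    \<in> borel_measurable (exchangeable_algebra K t \<Otimes>\<^sub>M exchangeable_algebra L s)"
    (is "?A E \<in> borel_measurable ?N")
  using Int_stable_pair_measure_generator pair_measure_closed
    assms[unfolded sets_pair_measure]
proof (induction rule: sigma_sets_induct_disjoint)
  case (basic E)
  then obtain a b where E: "E = a \<times> b" and a: "a \<in> sets (sequences K)" and b: "b \<in> sets (sequences L)"
    by blast
  \<comment> \<open>The indicator of a rectangle is a product, so the double sum splits into one
    symmetrization per sample.\<close>
  have "?A E = (\<lambda>z. (\<Sum>p | p permutes {1..t}. indicator a (fst z \<circ> p)) * (\<Sum>q | q permutes {1..s}. indicator b (snd z \<circ> q)))"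
    by (simp add: E fun_eq_iff indicator_times sum_product case_prod_beta comp_def)
  moreover have "(\<lambda>z. (\<Sum>p | p permutes {1..t}. indicator a (fst z \<circ> p)) * (\<Sum>q | q permutes {1..s}. indicator b (snd z \<circ> q)) :: ennreal)
      \<in> borel_measurable ?N"
    by (intro borel_measurable_times_ennreal
      measurable_compose[OF measurable_fst measurable_symmetrization]
      measurable_compose[OF measurable_snd measurable_symmetrization]
      borel_measurable_indicator a b)
  ultimately show ?case
    by (simp only:)
next
  case empty
  show ?case
    by (simp add: case_prod_beta)
next
  case (compl E)
  \<comment> \<open>The constant counts the pairs of permutations. Subtraction in
    \<open>ennreal\<close> undoes an addition only for a finite subtrahend, hence
    \<open>fin\<close>.\<close>
  let ?c = "\<Sum>p | p permutes {1..t}. \<Sum>q | q permutes {1..s}. 1 :: ennreal"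
  have fin: "?A E z < \<top>" for z
    by (cases z) (auto simp: finite_permutations indicator_def of_nat_less_top intro!: ennreal_sum_less_top)
  have "?A (space (sequences K) \<times> space (sequences L) - E) z + ?A E z = ?c" if "z \<in> space ?N" for z
  proof -
    obtain x y where z: "z = (x, y)"
      by fastforce
    have "indicator (space (sequences K) \<times> space (sequences L) - E) (x \<circ> p, y \<circ> q)
        + indicator E (x \<circ> p, y \<circ> q) = (1::ennreal)"
      if "p permutes {1..t}" "q permutes {1..s}" for p q
      using that \<open>z \<in> space ?N\<close> permute_coordinates_in_space[of p t x K]
        permute_coordinates_in_space[of q s y L]
      by (auto simp: z indicator_def space_pair_measure)
    then show ?thesis
      unfolding z prod.case sum.distrib[symmetric] by (intro sum.cong refl) auto
  qed
  then have "?A (space (sequences K) \<times> space (sequences L) - E) z = ?c - ?A E z" if "z \<in> space ?N" for z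
    using fin that by (metis ennreal_add_diff_cancel_right order_less_irrefl)
  then have "?A (space (sequences K) \<times> space (sequences L) - E) \<in> borel_measurable ?N \<longleftrightarrow>
      (\<lambda>z. ?c - ?A E z) \<in> borel_measurable ?N"
    by (intro measurable_cong)
  then show ?case
    by (rule iffD2) (intro borel_measurable_minus_ennreal borel_measurable_const compl)
next
  case (union E)
  \<comment> \<open>Disjointness makes the indicator of the union the series of the
    indicators.\<close>
  have "?A (\<Union>i. E i) = (\<lambda>z. \<Sum>i. ?A (E i) z)"
    using union(1) by (auto simp: fun_eq_iff suminf_sum suminf_indicator[symmetric])
  moreover have "(\<lambda>z. \<Sum>i. ?A (E i) z) \<in> borel_measurable ?N"
    by (intro borel_measurable_suminf_order union)
  ultimately show ?case
    by (simp only:)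
qed

text \<open>For \<open>D\<close> in the left algebra, all terms of its symmetrized indicator at a
  point equal the indicator itself, so the sum is nonzero exactly on \<open>D\<close>; the sum is
  measurable for the product, hence so is \<open>D\<close>. Conversely, rectangles with invariant
  sides are invariant and generate the product.\<close>

lemma sets_pair_exchangeable_algebra_eq:
  "sets (pair_exchangeable_algebra K L t s) = sets (exchangeable_algebra K t \<Otimes>\<^sub>M exchangeable_algebra L s)"
proof (intro equalityI subsetI)
  fix D assume D: "D \<in> sets (pair_exchangeable_algebra K L t s)"
  let ?N = "exchangeable_algebra K t \<Otimes>\<^sub>M exchangeable_algebra L s"
  let ?A = "\<lambda>(x, y). \<Sum>p | p permutes {1..t}. \<Sum>q | q permutes {1..s}. indicator D (x \<circ> p, y \<circ> q) :: ennreal"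
  have "?A \<in> borel_measurable ?N"
    using D by (intro measurable_pair_symmetrization) (auto simp: sets_pair_exchangeable_algebra)
  then have "?A -` (- {0}) \<inter> space ?N \<in> sets ?N"
    by (rule measurable_sets) auto
  moreover have A: "?A (x, y) \<noteq> 0 \<longleftrightarrow> (x, y) \<in> D"
    if xy: "x \<in> space (sequences K)" "y \<in> space (sequences L)" for x y
  proof -
    have "?A (x, y) = (\<Sum>p | p permutes {1..t}. \<Sum>q | q permutes {1..s}. indicator D (x, y))"
      using D xy by (auto simp: sets_pair_exchangeable_algebra indicator_def intro!: sum.cong)
    then show ?thesis
      by (auto simp: card_permutations indicator_def)
  qed
  have "D \<subseteq> space (sequences K) \<times> space (sequences L)"
    using D sets.sets_into_space[of D "sequences K \<Otimes>\<^sub>M sequences L"]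
    by (simp add: space_pair_measure sets_pair_exchangeable_algebra)
  then have "?A -` (- {0}) \<inter> space ?N = D"
    using A by (fastforce simp: space_pair_measure)
  ultimately show "D \<in> sets ?N"
    by simp
next
  fix D assume "D \<in> sets (exchangeable_algebra K t \<Otimes>\<^sub>M exchangeable_algebra L s)"
  moreover have "sets (exchangeable_algebra K t \<Otimes>\<^sub>M exchangeable_algebra L s)
      \<subseteq> sets (pair_exchangeable_algebra K L t s)"
    by (rule sets_pair_in_sets)
      (auto simp: sets_exchangeable_algebra sets_pair_exchangeable_algebra intro: permute_coordinates_in_space)
  ultimately show "D \<in> sets (pair_exchangeable_algebra K L t s)"
    by blast
qed

section \<open>Jensen's inequality for finite means of measures\<close>

text \<open>Means of probability measures are compared below through the real-valued
  \<open>measure\<close>, where they are ordinary arithmetic; finiteness makes this as good as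
  \<open>emeasure\<close>.\<close>

lemma prob_algebra_measure_eqI:
  assumes "\<mu> \<in> space (prob_algebra K)" "\<nu> \<in> space (prob_algebra K)"
    and "\<And>A. A \<in> sets K \<Longrightarrow> measure \<mu> A = measure \<nu> A"
  shows "\<mu> = \<nu>"
proof (rule measure_eqI)
  interpret \<mu>: prob_space \<mu> using assms by (simp add: space_prob_algebra)
  interpret \<nu>: prob_space \<nu> using assms by (simp add: space_prob_algebra)
  show "sets \<mu> = sets \<nu>" using assms by (simp add: space_prob_algebra)
  fix A assume "A \<in> sets \<mu>"
  then show "emeasure \<mu> A = emeasure \<nu> A"
    using assms by (simp add: space_prob_algebra \<mu>.emeasure_eq_measure \<nu>.emeasure_eq_measure)
qed

lemma measure_mixture:
  assumes "\<mu> \<in> space (prob_algebra K)" "\<nu> \<in> space (prob_algebra K)" "l \<in> {0..1}" "A \<in> sets K"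
  shows "measure (mixture l \<mu> \<nu>) A = l * measure \<mu> A + (1 - l) * measure \<nu> A"
proof -
  interpret \<mu>: prob_space \<mu> using assms by (simp add: space_prob_algebra)
  interpret \<nu>: prob_space \<nu> using assms by (simp add: space_prob_algebra)
  have "emeasure (mixture l \<mu> \<nu>) A = ennreal (l * measure \<mu> A + (1 - l) * measure \<nu> A)"
    using assms by (subst emeasure_mixture)
      (auto simp: space_prob_algebra \<mu>.emeasure_eq_measure \<nu>.emeasure_eq_measure ennreal_mult ennreal_plus)
  then show ?thesis
    using assms(3) by (intro measure_eq_emeasure_eq_ennreal) auto
qed

text \<open>Convexity is given for two-point mixtures only, so the mean measures are built by mixing
  in one index at a time. They are described by their values on sets.\<close>

lemma jointly_convex_mean_exists:
  assumes conv: "jointly_convex_functional S \<Psi>"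
    and "finite J" "J \<noteq> {}"
    and "\<And>j. j \<in> J \<Longrightarrow> \<mu> j \<in> prob_measures S" "\<And>j. j \<in> J \<Longrightarrow> \<nu> j \<in> prob_measures S"
    and "\<And>j. j \<in> J \<Longrightarrow> \<Psi> (\<mu> j) (\<nu> j) = ereal (f j)"
  shows "\<exists>\<mu>'\<in>prob_measures S. \<exists>\<nu>'\<in>prob_measures S.
    (\<forall>A\<in>sets (borel_of S). measure \<mu>' A = (\<Sum>j\<in>J. measure (\<mu> j) A) / card J \<and>
       measure \<nu>' A = (\<Sum>j\<in>J. measure (\<nu> j) A) / card J) \<and>
    \<Psi> \<mu>' \<nu>' \<le> ereal ((\<Sum>j\<in>J. f j) / card J)"
  using assms(2-)
proof (induction rule: finite_ne_induct)
  case (singleton j)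
  then show ?case
    by (intro bexI[of _ "\<mu> j"] bexI[of _ "\<nu> j"]) auto
next
  case (insert i J)
  then obtain \<mu>' \<nu>' where P: "\<mu>' \<in> prob_measures S" "\<nu>' \<in> prob_measures S"
    and m: "\<And>A. A \<in> sets (borel_of S) \<Longrightarrow> measure \<mu>' A = (\<Sum>j\<in>J. measure (\<mu> j) A) / card J"
      "\<And>A. A \<in> sets (borel_of S) \<Longrightarrow> measure \<nu>' A = (\<Sum>j\<in>J. measure (\<nu> j) A) / card J"
    and le: "\<Psi> \<mu>' \<nu>' \<le> ereal ((\<Sum>j\<in>J. f j) / card J)"
    by fastforce
  define n where "n = real (card J)"
  \<comment> \<open>The weight with which mixing a mean of \<open>n\<close> terms and one new term
    gives the mean of \<open>n + 1\<close> terms.\<close>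
  define l where "l = n / (n + 1)"
  have n: "n > 0"
    using insert by (simp add: n_def card_gt_0_iff)
  then have l: "l \<in> {0..1}" and l1: "1 - l = 1 / (n + 1)"
    by (auto simp: l_def field_simps)
  have mean: "l * (a / n) + (1 - l) * b = (b + a) / (n + 1)" for a b
    unfolding l1 using n by (simp add: l_def add_divide_distrib)
  have c: "real (card (insert i J)) = n + 1"
    using insert by (simp add: n_def)
  have i: "\<mu> i \<in> prob_measures S" "\<nu> i \<in> prob_measures S" "\<Psi> (\<mu> i) (\<nu> i) = ereal (f i)"
    using insert by auto
  have "\<Psi> (mixture l \<mu>' (\<mu> i)) (mixture l \<nu>' (\<nu> i)) \<le> ereal l * \<Psi> \<mu>' \<nu>' + ereal (1 - l) * \<Psi> (\<mu> i) (\<nu> i)"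
    using conv l P i unfolding jointly_convex_functional_def by blast
  also have "\<dots> \<le> ereal l * ereal ((\<Sum>j\<in>J. f j) / n) + ereal (1 - l) * ereal (f i)"
    using le l i by (intro add_mono ereal_mult_left_mono) (auto simp: n_def)
  also have "\<dots> = ereal ((\<Sum>j\<in>insert i J. f j) / card (insert i J))"
    unfolding c using insert mean[of "\<Sum>j\<in>J. f j" "f i"] by simp
  finally have "\<Psi> (mixture l \<mu>' (\<mu> i)) (mixture l \<nu>' (\<nu> i)) \<le> \<dots>" .
  moreover have "measure (mixture l \<mu>' (\<mu> i)) A = (\<Sum>j\<in>insert i J. measure (\<mu> j) A) / card (insert i J) \<and>
      measure (mixture l \<nu>' (\<nu> i)) A = (\<Sum>j\<in>insert i J. measure (\<nu> j) A) / card (insert i J)"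
    if A: "A \<in> sets (borel_of S)" for A
    unfolding c measure_mixture[OF P(1) i(1) l A] measure_mixture[OF P(2) i(2) l A] m[OF A]
    using insert mean[of "\<Sum>j\<in>J. measure (\<mu> j) A" "measure (\<mu> i) A"]
      mean[of "\<Sum>j\<in>J. measure (\<nu> j) A" "measure (\<nu> i) A"]
    by (simp flip: n_def)
  ultimately show ?case
    using mixture_in_prob_algebra[OF P(1) i(1) l] mixture_in_prob_algebra[OF P(2) i(2) l] by blast
qed

text \<open>A probability measure is determined by its values on sets, so the given
  \<open>\<mu>'\<close> and \<open>\<nu>'\<close> coincide with the mixtures from
  \<open>jointly_convex_mean_exists\<close>.\<close>

lemma jointly_convex_le_mean:
  assumes conv: "jointly_convex_functional S \<Psi>"
    and J: "finite J" "J \<noteq> {}"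
    and P: "\<And>j. j \<in> J \<Longrightarrow> \<mu> j \<in> prob_measures S" "\<And>j. j \<in> J \<Longrightarrow> \<nu> j \<in> prob_measures S"
    and fin: "\<And>j. j \<in> J \<Longrightarrow> \<bar>\<Psi> (\<mu> j) (\<nu> j)\<bar> \<noteq> \<infinity>"
    and P': "\<mu>' \<in> prob_measures S" "\<nu>' \<in> prob_measures S"
    and m: "\<And>A. A \<in> sets (borel_of S) \<Longrightarrow> measure \<mu>' A = (\<Sum>j\<in>J. measure (\<mu> j) A) / card J"
      "\<And>A. A \<in> sets (borel_of S) \<Longrightarrow> measure \<nu>' A = (\<Sum>j\<in>J. measure (\<nu> j) A) / card J"
  shows "\<Psi> \<mu>' \<nu>' \<le> ereal ((\<Sum>j\<in>J. real_of_ereal (\<Psi> (\<mu> j) (\<nu> j))) / card J)"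
proof -
  have eq: "\<Psi> (\<mu> j) (\<nu> j) = ereal (real_of_ereal (\<Psi> (\<mu> j) (\<nu> j)))" if "j \<in> J" for j
    using fin[OF that] by (simp add: ereal_real)
  obtain \<mu>'' \<nu>'' where P'': "\<mu>'' \<in> prob_measures S" "\<nu>'' \<in> prob_measures S"
    and m'': "\<And>A. A \<in> sets (borel_of S) \<Longrightarrow> measure \<mu>'' A = (\<Sum>j\<in>J. measure (\<mu> j) A) / card J"
      "\<And>A. A \<in> sets (borel_of S) \<Longrightarrow> measure \<nu>'' A = (\<Sum>j\<in>J. measure (\<nu> j) A) / card J"
    and le: "\<Psi> \<mu>'' \<nu>'' \<le> ereal ((\<Sum>j\<in>J. real_of_ereal (\<Psi> (\<mu> j) (\<nu> j))) / card J)"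
    using jointly_convex_mean_exists[OF conv J, of \<mu> \<nu> "\<lambda>j. real_of_ereal (\<Psi> (\<mu> j) (\<nu> j))"] P eq
    by blast
  have "\<mu>' = \<mu>''" "\<nu>' = \<nu>''"
    using m m'' by (auto intro!: prob_algebra_measure_eqI[OF P'(1) P''(1)] prob_algebra_measure_eqI[OF P'(2) P''(2)])
  then show ?thesis
    using le by simp
qed

text \<open>Lets the one-sample inequality be read off from the two-sample one.\<close>

lemma jointly_convex_functional_const:
  assumes "convex_functional S \<Phi>"
  shows "jointly_convex_functional S (\<lambda>\<mu> \<nu>. \<Phi> \<mu>)"
  using assms by (auto simp: convex_functional_def jointly_convex_functional_def)

section \<open>Empirical measures under permutations of the sample\<close>

lemma measure_empirical_measure:
  assumes "A \<in> sets K" "t \<ge> 1"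
  shows "measure (empirical_measure K t x) A = (\<Sum>i=1..t. indicator A (x i)) / t"
proof -
  have "emeasure (empirical_measure K t x) A = (\<Sum>i=1..t. ennreal (indicator A (x i))) / ennreal t"
    using assms by (simp add: emeasure_empirical_measure ennreal_indicator ennreal_of_nat_eq_real_of_nat)
  also have "\<dots> = ennreal ((\<Sum>i=1..t. indicator A (x i)) / t)"
    using assms by (simp add: sum_nonneg divide_ennreal)
  finally show ?thesis
    by (simp add: measure_def sum_nonneg)
qed

lemma empirical_measure_cong:
  assumes "\<And>i. i \<in> {1..t} \<Longrightarrow> x i = y i"
  shows "empirical_measure K t x = empirical_measure K t y"
proof -
  have "(\<Sum>i=1..t. emeasure (return K (x i)) A) = (\<Sum>i=1..t. emeasure (return K (y i)) A)" for A
    using assms by (intro sum.cong) auto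
  then show ?thesis
    unfolding empirical_measure_def by simp
qed

lemma empirical_measure_permute:
  assumes "p permutes {1..t}"
  shows "empirical_measure K t (x \<circ> p) = empirical_measure K t x"
proof -
  have "(\<Sum>i=1..t. emeasure (return K (x i)) A) = (\<Sum>i=1..t. emeasure (return K ((x \<circ> p) i)) A)" for A
    using sum.permute[OF assms, of "\<lambda>i. emeasure (return K (x i)) A"] by (simp add: comp_def)
  then show ?thesis
    unfolding empirical_measure_def by simp
qed

text \<open>Composing with the transposition of \<open>i\<close> and \<open>j\<close> shows that the
  sum is the same for every point of \<open>U\<close>. When it is added up over \<open>U\<close> and
  the sums are exchanged, each permutation contributes the full sum of \<open>f\<close>.\<close>

lemma sum_permutations_apply:
  fixes f :: "'i \<Rightarrow> real"
  assumes "finite U" "i \<in> U"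
  shows "(\<Sum>p | p permutes U. f (p i)) = card {p. p permutes U} * ((\<Sum>j\<in>U. f j) / card U)"
proof -
  have const: "(\<Sum>p | p permutes U. f (p j)) = (\<Sum>p | p permutes U. f (p i))" if "j \<in> U" for j
    using sum_permutations_compose_right[OF permutes_swap_id[OF assms(2) that], of "\<lambda>p. f (p j)"]
    by simp
  have "card U * (\<Sum>p | p permutes U. f (p i)) = (\<Sum>j\<in>U. \<Sum>p | p permutes U. f (p j))"
    using const by simp
  also have "\<dots> = (\<Sum>p | p permutes U. \<Sum>j\<in>U. f (p j))"
    by (rule sum.swap)
  also have "\<dots> = (\<Sum>p | p permutes U. \<Sum>j\<in>U. f j)"
  proof (rule sum.cong[OF refl])
    fix p assume "p \<in> {p. p permutes U}"
    then show "(\<Sum>j\<in>U. f (p j)) = (\<Sum>j\<in>U. f j)"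
      using sum.permute[of p U f] by (simp add: comp_def)
  qed
  also have "\<dots> = card {p. p permutes U} * (\<Sum>j\<in>U. f j)"
    by simp
  finally have "card U * (\<Sum>p | p permutes U. f (p i)) = card {p. p permutes U} * (\<Sum>j\<in>U. f j)" .
  moreover have "card U \<noteq> 0"
    using assms by auto
  ultimately show ?thesis
    by (simp add: field_simps)
qed

text \<open>A uniformly random permutation of \<open>{1..t'}\<close> sends each fixed index
  \<open>i \<le> t\<close> to a uniformly distributed index, so each of the \<open>t\<close>
  indicators averages to the empirical measure at \<open>t'\<close>.\<close>

lemma empirical_measure_mean_permutations:
  assumes "A \<in> sets K" "1 \<le> t" "t \<le> t'"
  shows "measure (empirical_measure K t' x) A =
    (\<Sum>p | p permutes {1..t'}. measure (empirical_measure K t (x \<circ> p)) A) / card {p. p permutes {1..t'}}"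
proof -
  let ?G = "{p. p permutes {1..t'}}"
  have c: "card ?G > 0"
    using card_permutations[of "{1..t'}" t'] by simp
  have "(\<Sum>p\<in>?G. measure (empirical_measure K t (x \<circ> p)) A) = (\<Sum>p\<in>?G. (\<Sum>i=1..t. indicator A (x (p i))) / t)"
    using assms by (simp add: measure_empirical_measure)
  also have "\<dots> = (\<Sum>i=1..t. \<Sum>p\<in>?G. indicator A (x (p i))) / t"
    by (simp add: sum_divide_distrib[symmetric] sum.swap[of _ _ ?G])
  also have "\<dots> = (\<Sum>i=1..t. card ?G * ((\<Sum>j=1..t'. indicator A (x j)) / t')) / t"
    using assms sum_permutations_apply[of "{1..t'}" _ "\<lambda>j. indicator A (x j)"] by simp
  also have "\<dots> = card ?G * measure (empirical_measure K t' x) A"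
    using assms by (simp add: measure_empirical_measure)
  finally show ?thesis
    using c by simp
qed

section \<open>Law of the sample sequence and its invariance\<close>

lemma sample_path_measurable:
  assumes "prob_space M" "iid_sequence M K X P"
  shows "sample_path X \<in> measurable M (sequences K)"
  using assms unfolding iid_sequence_def sample_path_def
  by (auto simp: prob_space.indep_vars_def intro!: measurable_restrict)

lemma distr_sample_path:
  assumes "prob_space M" "iid_sequence M K X P"
  shows "distr M (sequences K) (sample_path X) = sequences P"
proof -
  interpret prob_space M by fact
  have ind: "indep_vars (\<lambda>_. K) X {1..}" and P: "\<And>i. i \<ge> 1 \<Longrightarrow> distr M K (X i) = P"
    using assms(2) by (auto simp: iid_sequence_def)
  have "distr M (sequences K) (sample_path X) = PiM {1..} (\<lambda>i. distr M K (X i))"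
    using ind indep_vars_iff_distr_eq_PiM'[where I = "{1..}" and M' = "\<lambda>_. K" and X = X]
    by (simp add: indep_vars_def sample_path_def[abs_def])
  also have "\<dots> = sequences P"
    using P by (intro PiM_cong) auto
  finally show ?thesis .
qed

lemma distr_sequences_permute:
  assumes "prob_space P" "sets P = sets K" "p permutes {1..t}"
  shows "distr (sequences P) (sequences K) (\<lambda>x. x \<circ> p) = sequences P"
proof -
  have pI: "p i \<in> {1..} \<longleftrightarrow> i \<in> {1..}" for i
    using assms(3) permutes_in_image[OF assms(3), of i] permutes_not_in[OF assms(3), of i] by fastforce
  \<comment> \<open>To reach the shape of \<open>distr_PiM_reindex\<close>, composition with
    \<open>p\<close> is written as a restricted re-indexing and the target becomes
    \<open>sequences P\<close>, which has the same sets as \<open>sequences K\<close>.\<close>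
  have "distr (sequences P) (sequences K) (\<lambda>x. x \<circ> p) = distr (sequences P) (sequences P) (\<lambda>x. \<lambda>i\<in>{1..}. x (p i))"
  proof (rule distr_cong)
    show "sets (sequences K) = sets (sequences P)"
      using assms(2) by (intro sets_PiM_cong) auto
    fix x assume x: "x \<in> space (sequences P)"
    show "x \<circ> p = (\<lambda>i\<in>{1..}. x (p i))"
    proof
      fix i show "(x \<circ> p) i = (\<lambda>i\<in>{1..}. x (p i)) i"
        using pI[of i] x PiE_arb[of x "{1..}" _ "p i"] by (auto simp: space_PiM)
    qed
  qed simp
  also have "\<dots> = sequences P"
    using pI assms(1) permutes_inj_on[OF assms(3)]
    by (intro distr_PiM_reindex) auto
  finally show ?thesis .
qed

lemma empirical_measure_restrict [simp]:
  "empirical_measure K t (restrict x {1..t}) = empirical_measure K t x"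
  by (rule empirical_measure_cong) simp

text \<open>The empirical measure at \<open>t\<close> reads only the coordinates 1 to
  \<open>t\<close>, so the functional factors through the restriction to \<open>{1..t}\<close>,
  where measurability is given.\<close>

lemma empirical_functional_measurable:
  assumes "(\<lambda>x. \<Phi> (empirical_measure K t x)) \<in> borel_measurable (PiM {1..t} (\<lambda>_. K))"
  shows "(\<lambda>x. \<Phi> (empirical_measure K t x)) \<in> borel_measurable (sequences K)"
proof -
  have "(\<lambda>x. restrict x {1..t}) \<in> measurable (sequences K) (PiM {1..t} (\<lambda>_. K))"
    by (rule measurable_restrict_subset) auto
  from measurable_compose[OF this assms] show ?thesis
    by simp
qed

lemma empirical_functional_measurable_pair:
  assumes "(\<lambda>(x, y). \<Psi> (empirical_measure K t x) (empirical_measure L s y))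
    \<in> borel_measurable (PiM {1..t} (\<lambda>_. K) \<Otimes>\<^sub>M PiM {1..s} (\<lambda>_. L))"
  shows "(\<lambda>(x, y). \<Psi> (empirical_measure K t x) (empirical_measure L s y))
    \<in> borel_measurable (sequences K \<Otimes>\<^sub>M sequences L)"
proof -
  have "(\<lambda>z. (restrict (fst z) {1..t}, restrict (snd z) {1..s}))
      \<in> measurable (sequences K \<Otimes>\<^sub>M sequences L) (PiM {1..t} (\<lambda>_. K) \<Otimes>\<^sub>M PiM {1..s} (\<lambda>_. L))"
    by (intro measurable_Pair measurable_compose[OF measurable_fst measurable_restrict_subset]
      measurable_compose[OF measurable_snd measurable_restrict_subset]) auto
  from measurable_compose[OF this assms] show ?thesis
    by (simp add: case_prod_beta)
qed

lemma empirical_measure_sample_path: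
  "empirical_measure K t (sample_path X \<omega>) = empirical_measure K t (\<lambda>i. X i \<omega>)"
  by (rule empirical_measure_cong) (simp add: sample_path_def)

lemma empirical_measure_sequences:
  assumes "t \<ge> 1" "x \<in> space (sequences (borel_of S))"
  shows "empirical_measure (borel_of S) t x \<in> prob_measures S"
  using assms by (intro empirical_measure_in_prob_algebra) (auto simp: space_PiM)

section \<open>Jensen's inequality for permuted empirical measures\<close>

text \<open>Joint convexity uses the same weights in both arguments, so the two means run over one
  index set \<open>J\<close> of pairs; in each argument it reduces to the mean over that sample's
  own permutations.\<close>

lemma jointly_convex_empirical_le_mean:
  assumes conv: "jointly_convex_functional S \<Psi>"
    and ts: "1 \<le> t" "t \<le> t'" "1 \<le> s" "s \<le> s'"
    and xy: "x \<in> space (sequences (borel_of S))" "y \<in> space (sequences (borel_of S))"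
    and J: "J = {p. p permutes {1..t'}} \<times> {q. q permutes {1..s'}}"
    and fin: "\<And>p q. (p, q) \<in> J \<Longrightarrow> \<bar>\<Psi> (empirical_measure (borel_of S) t (x \<circ> p)) (empirical_measure (borel_of S) s (y \<circ> q))\<bar> \<noteq> \<infinity>"
  shows "\<Psi> (empirical_measure (borel_of S) t' x) (empirical_measure (borel_of S) s' y) \<le>
    ereal ((\<Sum>(p, q)\<in>J. real_of_ereal (\<Psi> (empirical_measure (borel_of S) t (x \<circ> p)) (empirical_measure (borel_of S) s (y \<circ> q)))) / card J)"
proof -
  let ?G = "{p. p permutes {1..t'}}" and ?H = "{q. q permutes {1..s'}}"
  have G: "finite ?G" "?G \<noteq> {}" "card ?G > 0" and H: "finite ?H" "?H \<noteq> {}" "card ?H > 0"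
    using permutes_id by (auto simp: finite_permutations card_gt_0_iff intro: permutes_id)
  have "\<Psi> (empirical_measure (borel_of S) t' x) (empirical_measure (borel_of S) s' y) \<le>
    ereal ((\<Sum>j\<in>J. real_of_ereal (\<Psi> (empirical_measure (borel_of S) t (x \<circ> fst j)) (empirical_measure (borel_of S) s (y \<circ> snd j)))) / card J)"
  proof (rule jointly_convex_le_mean[OF conv])
    show "finite J" "J \<noteq> {}"
      using G H by (auto simp: J)
    show "empirical_measure (borel_of S) t (x \<circ> fst j) \<in> prob_measures S"
        "empirical_measure (borel_of S) s (y \<circ> snd j) \<in> prob_measures S" if "j \<in> J" for j
      using that ts xy by (auto simp: J intro!: empirical_measure_sequences permute_coordinates_in_space)
    show "empirical_measure (borel_of S) t' x \<in> prob_measures S"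
        "empirical_measure (borel_of S) s' y \<in> prob_measures S"
      using ts xy by (auto intro!: empirical_measure_sequences)
    show "\<bar>\<Psi> (empirical_measure (borel_of S) t (x \<circ> fst j)) (empirical_measure (borel_of S) s (y \<circ> snd j))\<bar> \<noteq> \<infinity>"
      if "j \<in> J" for j
      using fin[of "fst j" "snd j"] that by simp
    fix A :: "'a set" assume A: "A \<in> sets (borel_of S)"
    \<comment> \<open>The summand ignores \<open>snd j\<close>, which gives the factor
      \<open>card ?H\<close>; it cancels against \<open>card J\<close>, the product of the two
      cardinalities.\<close>
    have "(\<Sum>j\<in>J. measure (empirical_measure (borel_of S) t (x \<circ> fst j)) A) =
        card ?H * (\<Sum>p\<in>?G. measure (empirical_measure (borel_of S) t (x \<circ> p)) A)"
      by (simp add: J sum.cartesian_product' sum_distrib_left)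
    then show "measure (empirical_measure (borel_of S) t' x) A =
        (\<Sum>j\<in>J. measure (empirical_measure (borel_of S) t (x \<circ> fst j)) A) / card J"
      using empirical_measure_mean_permutations[OF A ts(1,2), of x] H(3) by (simp add: J card_cartesian_product)
    have "(\<Sum>j\<in>J. measure (empirical_measure (borel_of S) s (y \<circ> snd j)) A) =
        card ?G * (\<Sum>q\<in>?H. measure (empirical_measure (borel_of S) s (y \<circ> q)) A)"
      by (simp add: J sum.cartesian_product' sum_distrib_left)
    then show "measure (empirical_measure (borel_of S) s' y) A =
        (\<Sum>j\<in>J. measure (empirical_measure (borel_of S) s (y \<circ> snd j)) A) / card J"
      using empirical_measure_mean_permutations[OF A ts(3,4), of y] G(3) by (simp add: J card_cartesian_product)
  qed
  then show ?thesis
    by (simp add: case_prod_beta)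
qed

lemma convex_empirical_le_mean:
  assumes conv: "convex_functional S \<Phi>"
    and ts: "1 \<le> t" "t \<le> t'"
    and x: "x \<in> space (sequences (borel_of S))"
    and fin: "\<And>p. p permutes {1..t'} \<Longrightarrow> \<bar>\<Phi> (empirical_measure (borel_of S) t (x \<circ> p))\<bar> \<noteq> \<infinity>"
  shows "\<Phi> (empirical_measure (borel_of S) t' x) \<le>
    ereal ((\<Sum>p | p permutes {1..t'}. real_of_ereal (\<Phi> (empirical_measure (borel_of S) t (x \<circ> p)))) / card {p. p permutes {1..t'}})"
  \<comment> \<open>The second sample is a dummy: \<open>x\<close> once more, with
    \<open>s = s' = 1\<close>, where the identity is the only permutation.\<close>
  using jointly_convex_empirical_le_mean[OF jointly_convex_functional_const[OF conv] ts order_refl order_refl x x refl] fin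
  by (simp add: card_cartesian_product sum.cartesian_product')

section \<open>Reverse submartingale property for one sample\<close>

theorem reverse_submartingale_convex_empirical:
  assumes M: "prob_space M" and P: "prob_space P" "sets P = sets (borel_of S)"
    and iid: "iid_sequence M (borel_of S) X P"
    and conv: "convex_functional S \<Phi>"
    and meas: "\<And>t. t \<ge> 1 \<Longrightarrow>
           (\<lambda>x. \<Phi> (empirical_measure (borel_of S) t x))
             \<in> borel_measurable (PiM {1..t} (\<lambda>_. borel_of S))"
    and int: "\<And>t. t \<ge> 1 \<Longrightarrow>
           integrable_ereal M (\<lambda>\<omega>. \<Phi> (empirical_measure (borel_of S) t (\<lambda>i. X i \<omega>)))"
  shows "reverse_submartingale M (exchangeable_filtration M (borel_of S) X)
           (\<lambda>t \<omega>. \<Phi> (empirical_measure (borel_of S) t (\<lambda>i. X i \<omega>)))"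
proof -
  let ?K = "borel_of S" and ?E = "exchangeable_filtration M (borel_of S) X"
  let ?g = "\<lambda>t x. \<Phi> (empirical_measure (borel_of S) t x)"
  note X = sample_path_measurable[OF M iid]
  have eq: "\<Phi> (empirical_measure ?K t (\<lambda>i. X i \<omega>)) = ?g t (sample_path X \<omega>)" for t \<omega>
    by (simp add: empirical_measure_sample_path)
  have g: "?g t \<in> borel_measurable (sequences ?K)" if "t \<ge> 1" for t
    by (rule empirical_functional_measurable[OF meas[OF that]])
  \<comment> \<open>Permuting the first \<open>t\<close> observations leaves their empirical measure
    unchanged, so \<open>?g t\<close> is measurable for the invariant sets of sequences.\<close>
  have adapted: "(\<lambda>\<omega>. ?g t (sample_path X \<omega>)) \<in> borel_measurable (?E t)" if "t \<ge> 1" for t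
  proof (rule measurable_compose[OF sample_path_measurable_exchangeable[OF X]])
    show "?g t \<in> borel_measurable (exchangeable_algebra ?K t)"
      by (rule measurable_invariant_algebra[OF _ g[OF that]])
        (auto simp: empirical_measure_permute intro: permute_coordinates_in_space)
  qed
  \<comment> \<open>The averaging group is that of \<open>{1..t+1}\<close>: its means carry the
    empirical measure at \<open>t\<close> to the one at \<open>t + 1\<close>, and its invariant sets
    define \<open>?E (t + 1)\<close>.\<close>
  have "AE \<omega> in M. ?g (t + 1) (sample_path X \<omega>) \<le> cond_exp_ereal M (?E (t + 1)) (\<lambda>\<omega>. ?g t (sample_path X \<omega>)) \<omega>"
    if t: "t \<ge> 1" for t
  proof (rule cond_exp_ge_of_invariant_mean[where N = "sequences ?K" and T = "\<lambda>p x. x \<circ> p" and J = "{p. p permutes {1..t+1}}", OF M X])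
    fix p assume "p \<in> {p. p permutes {1..t+1}}"
    then have p: "p permutes {1..t+1}" by simp
    show "(\<lambda>x. x \<circ> p) \<in> measurable (sequences ?K) (sequences ?K)"
      by (rule measurable_permute_coordinates[OF p]) auto
    show "distr (distr M (sequences ?K) (sample_path X)) (sequences ?K) (\<lambda>x. x \<circ> p) = distr M (sequences ?K) (sample_path X)"
      unfolding distr_sample_path[OF M iid] by (rule distr_sequences_permute[OF P p])
  next
    fix \<omega> assume \<omega>: "\<omega> \<in> space M"
      and fin: "\<And>p. p \<in> {p. p permutes {1..t+1}} \<Longrightarrow> \<bar>?g t (sample_path X \<omega> \<circ> p)\<bar> \<noteq> \<infinity>"
    show "?g (t + 1) (sample_path X \<omega>) \<le> ereal ((\<Sum>p | p permutes {1..t+1}. real_of_ereal (?g t (sample_path X \<omega> \<circ> p))) / card {p. p permutes {1..t+1}})"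
      by (rule convex_empirical_le_mean[OF conv t _ measurable_space[OF X \<omega>]]) (use fin in auto)
  next
    show "integrable_ereal M (\<lambda>\<omega>. ?g t (sample_path X \<omega>))" "integrable_ereal M (\<lambda>\<omega>. ?g (t + 1) (sample_path X \<omega>))"
      using int t by (simp_all add: eq[symmetric])
    show "sets (?E (t + 1)) \<subseteq> sets (vimage_algebra (space M) (sample_path X) (exchangeable_algebra ?K (t + 1)))"
      by (simp add: sets_exchangeable_filtration[OF X])
    show "{p. p permutes {1..t+1}} \<noteq> {}"
      using permutes_id by blast
  qed (use t g adapted in \<open>auto simp: finite_permutations\<close>)
  then show ?thesis
    unfolding reverse_submartingale_def reverse_filtration_def eq
    using adapted subalgebra_exchangeable_filtration[OF X] exchangeable_filtration_antimono[OF X]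
      int[unfolded eq]
    by auto
qed

section \<open>Partially ordered reverse submartingale property for two samples\<close>

theorem reverse_submartingale_jointly_convex_empirical:
  assumes M: "prob_space M"
    and P: "prob_space P" "sets P = sets (borel_of S)" and Q: "prob_space Q" "sets Q = sets (borel_of S)"
    and iid: "iid_sequence M (borel_of S) X P" "iid_sequence M (borel_of S) Y Q"
    and indep: "independent_sequences M (borel_of S) X Y"
    and conv: "jointly_convex_functional S \<Psi>"
    and meas: "\<And>t s. t \<ge> 1 \<Longrightarrow> s \<ge> 1 \<Longrightarrow>
           (\<lambda>(x, y). \<Psi> (empirical_measure (borel_of S) t x) (empirical_measure (borel_of S) s y))
             \<in> borel_measurable (PiM {1..t} (\<lambda>_. borel_of S) \<Otimes>\<^sub>M PiM {1..s} (\<lambda>_. borel_of S))"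
    and int: "\<And>t s. t \<ge> 1 \<Longrightarrow> s \<ge> 1 \<Longrightarrow>
           integrable_ereal M (\<lambda>\<omega>. \<Psi> (empirical_measure (borel_of S) t (\<lambda>i. X i \<omega>))
                                      (empirical_measure (borel_of S) s (\<lambda>j. Y j \<omega>)))"
  shows "partially_ordered_reverse_submartingale M
           (\<lambda>t s. sigma (space M) (sets (exchangeable_filtration M (borel_of S) X t) \<union>
                                   sets (exchangeable_filtration M (borel_of S) Y s)))
           (\<lambda>t s \<omega>. \<Psi> (empirical_measure (borel_of S) t (\<lambda>i. X i \<omega>))
                       (empirical_measure (borel_of S) s (\<lambda>j. Y j \<omega>)))"
proof -
  let ?K = "borel_of S"
  let ?EX = "exchangeable_filtration M ?K X" and ?EY = "exchangeable_filtration M ?K Y"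
  define F where "F t s = sigma (space M) (sets (?EX t) \<union> sets (?EY s))" for t s
  define Z where "Z \<omega> = (sample_path X \<omega>, sample_path Y \<omega>)" for \<omega>
  define g where "g t s = (\<lambda>(x, y). \<Psi> (empirical_measure ?K t x) (empirical_measure ?K s y))" for t s
  note X = sample_path_measurable[OF M iid(1)] and Y = sample_path_measurable[OF M iid(2)]
  have Z: "Z \<in> measurable M (sequences ?K \<Otimes>\<^sub>M sequences ?K)"
    unfolding Z_def[abs_def] by (rule measurable_Pair[OF X Y])
  \<comment> \<open>Independence makes the joint law a product, whose factors are each unchanged by
    permutations of their own coordinates.\<close>
  have law: "distr M (sequences ?K \<Otimes>\<^sub>M sequences ?K) Z = sequences P \<Otimes>\<^sub>M sequences Q"
    using indep unfolding independent_sequences_def prob_space.indep_var_distribution_eq[OF M]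
    by (simp add: Z_def[abs_def] distr_sample_path[OF M iid(1)] distr_sample_path[OF M iid(2)])
  have eq: "\<Psi> (empirical_measure ?K t (\<lambda>i. X i \<omega>)) (empirical_measure ?K s (\<lambda>j. Y j \<omega>)) = g t s (Z \<omega>)" for t s \<omega>
    by (simp add: empirical_measure_sample_path g_def Z_def)
  have g: "g t s \<in> borel_measurable (sequences ?K \<Otimes>\<^sub>M sequences ?K)" if "t \<ge> 1" "s \<ge> 1" for t s
    unfolding g_def by (rule empirical_functional_measurable_pair[OF meas[OF that]])
  have gen: "sets (?EX t) \<union> sets (?EY s) \<subseteq> Pow (space M)" for t s
    using sets.space_closed[of "?EX t"] sets.space_closed[of "?EY s"] by simp
  have space_F [simp]: "space (F t s) = space M" for t s
    unfolding F_def using gen by (rule space_measure_of)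
  have sets_F: "sets (F t s) = sigma_sets (space M) (sets (?EX t) \<union> sets (?EY s))" for t s
    unfolding F_def using gen by (rule sets_measure_of)
  have sub: "subalgebra M (F t s)" for t s
    using subalgebra_exchangeable_filtration[OF X, of t] subalgebra_exchangeable_filtration[OF Y, of s]
    unfolding subalgebra_def by (auto simp: sets_F intro!: sets.sigma_sets_subset)
  have antimono: "sets (F t' s') \<subseteq> sets (F t s)" if "t \<le> t'" "s \<le> s'" for t t' s s'
    unfolding sets_F using exchangeable_filtration_antimono[OF X that(1)] exchangeable_filtration_antimono[OF Y that(2)]
    by (intro sigma_sets_mono') auto
  have X_F: "sample_path X \<in> measurable (F t s) (exchangeable_algebra ?K t)"
    and Y_F: "sample_path Y \<in> measurable (F t s) (exchangeable_algebra ?K s)" for t s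
    using sample_path_measurable_exchangeable[OF X, of t] sample_path_measurable_exchangeable[OF Y, of s]
    by (auto simp: measurable_def sets_F)
  \<comment> \<open>Here the symmetrization argument enters: \<open>Z\<close> is measurable into the
    product of the invariant algebras, and these are all the sets invariant under separate
    permutations. Adaptedness then needs only the invariance of \<open>g t s\<close>.\<close>
  have Z_F: "Z \<in> measurable (F t s) (pair_exchangeable_algebra ?K ?K t s)" for t s
    unfolding measurable_cong_sets[OF refl sets_pair_exchangeable_algebra_eq] Z_def[abs_def]
    by (rule measurable_Pair[OF X_F Y_F])
  have adapted: "(\<lambda>\<omega>. g t s (Z \<omega>)) \<in> borel_measurable (F t s)" if "t \<ge> 1" "s \<ge> 1" for t s
  proof (rule measurable_compose[OF Z_F])
    show "g t s \<in> borel_measurable (pair_exchangeable_algebra ?K ?K t s)"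
      by (rule measurable_invariant_algebra[OF _ g[OF that]])
        (auto simp: g_def empirical_measure_permute space_pair_measure intro: permute_coordinates_in_space)
  qed
  \<comment> \<open>Both components of \<open>Z\<close> are measurable for the pullback algebra,
    which therefore contains the generators of \<open>F t s\<close>.\<close>
  have F_vimage: "sets (F t s) \<subseteq> sets (vimage_algebra (space M) Z (pair_exchangeable_algebra ?K ?K t s))" for t s
  proof -
    let ?V = "vimage_algebra (space M) Z (pair_exchangeable_algebra ?K ?K t s)"
    have "Z \<in> measurable ?V (exchangeable_algebra ?K t \<Otimes>\<^sub>M exchangeable_algebra ?K s)"
      unfolding measurable_cong_sets[OF refl sets_pair_exchangeable_algebra_eq[symmetric]]
      using measurable_space[OF Z] by (intro measurable_vimage_algebra1) auto
    then have V: "sample_path X \<in> measurable ?V (exchangeable_algebra ?K t)"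
        "sample_path Y \<in> measurable ?V (exchangeable_algebra ?K s)"
      unfolding measurable_pair_iff by (simp_all add: Z_def comp_def)
    have "sets (?EX t) \<subseteq> sets ?V" "sets (?EY s) \<subseteq> sets ?V"
      unfolding sets_exchangeable_filtration[OF X] sets_exchangeable_filtration[OF Y]
      using sets_image_in_sets[OF _ V(1), of "space M"] sets_image_in_sets[OF _ V(2), of "space M"]
      by simp_all
    then show ?thesis
      unfolding sets_F using sets.sigma_sets_subset[of _ ?V] by simp
  qed
  have "AE \<omega> in M. g t' s' (Z \<omega>) \<le> cond_exp_ereal M (F t' s') (\<lambda>\<omega>. g t s (Z \<omega>)) \<omega>"
    if ts: "1 \<le> t" "t \<le> t'" "1 \<le> s" "s \<le> s'" for t t' s s'
  proof (rule cond_exp_ge_of_invariant_mean[where T = permute_pair, OF M Z])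
    let ?J = "{p. p permutes {1..t'}} \<times> {q. q permutes {1..s'}}"
    show "sets (F t' s') \<subseteq> sets (vimage_algebra (space M) Z (pair_exchangeable_algebra ?K ?K t' s'))"
      by (rule F_vimage)
    show "finite ?J" "?J \<noteq> {}"
      by (auto simp: finite_permutations intro: permutes_id)
    show "integrable_ereal M (\<lambda>\<omega>. g t s (Z \<omega>))" "integrable_ereal M (\<lambda>\<omega>. g t' s' (Z \<omega>))"
      using int ts by (simp_all add: eq[symmetric])
    show "g t s \<in> borel_measurable (sequences ?K \<Otimes>\<^sub>M sequences ?K)" "(\<lambda>\<omega>. g t' s' (Z \<omega>)) \<in> borel_measurable (F t' s')"
      using g adapted ts by auto
    show "space (F t' s') = space M"
      by simp
    fix \<omega> assume \<omega>: "\<omega> \<in> space M"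
      and fin: "\<And>j. j \<in> ?J \<Longrightarrow> \<bar>g t s (permute_pair j (Z \<omega>))\<bar> \<noteq> \<infinity>"
    have "g t' s' (Z \<omega>) \<le> ereal ((\<Sum>(p, q)\<in>?J. real_of_ereal (\<Psi> (empirical_measure ?K t (sample_path X \<omega> \<circ> p))
        (empirical_measure ?K s (sample_path Y \<omega> \<circ> q)))) / card ?J)"
      unfolding g_def Z_def prod.case
      by (rule jointly_convex_empirical_le_mean[OF conv ts measurable_space[OF X \<omega>] measurable_space[OF Y \<omega>] refl])
        (use fin in \<open>force simp: g_def Z_def\<close>)
    then show "g t' s' (Z \<omega>) \<le> ereal ((\<Sum>j\<in>?J. real_of_ereal (g t s (permute_pair j (Z \<omega>)))) / card ?J)"
      by (simp add: g_def Z_def case_prod_beta)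
  next
    fix j assume "j \<in> {p. p permutes {1..t'}} \<times> {q. q permutes {1..s'}}"
    then obtain p q where j: "j = (p, q)" and p: "p permutes {1..t'}" and q: "q permutes {1..s'}"
      by blast
    have mp: "(\<lambda>x. x \<circ> p) \<in> measurable (sequences ?K) (sequences ?K)"
      and mq: "(\<lambda>y. y \<circ> q) \<in> measurable (sequences ?K) (sequences ?K)"
      by (rule measurable_permute_coordinates[OF p] measurable_permute_coordinates[OF q]; auto)+
    have pj: "permute_pair j = (\<lambda>(x, y). (x \<circ> p, y \<circ> q))"
      by (simp add: j)
    show "permute_pair j \<in> measurable (sequences ?K \<Otimes>\<^sub>M sequences ?K) (sequences ?K \<Otimes>\<^sub>M sequences ?K)"
      unfolding j prod.case case_prod_beta fst_conv snd_conv
      by (intro measurable_Pair measurable_compose[OF measurable_fst mp] measurable_compose[OF measurable_snd mq])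
    have sets_PQ: "sets (sequences P) = sets (sequences ?K)" "sets (sequences Q) = sets (sequences ?K)"
      using P(2) Q(2) by (auto intro!: sets_PiM_cong)
    \<comment> \<open>Each factor equals its image under its own permutation, and the product of
      these images is the image of the product under the pair map.\<close>
    have "sequences P \<Otimes>\<^sub>M sequences Q =
        distr (sequences P) (sequences ?K) (\<lambda>x. x \<circ> p) \<Otimes>\<^sub>M distr (sequences Q) (sequences ?K) (\<lambda>y. y \<circ> q)"
      by (simp only: distr_sequences_permute[OF P p] distr_sequences_permute[OF Q q])
    also have "\<dots> = distr (sequences P \<Otimes>\<^sub>M sequences Q) (sequences ?K \<Otimes>\<^sub>M sequences ?K) (\<lambda>(x, y). (x \<circ> p, y \<circ> q))"
    proof (rule pair_measure_distr)
      show "sigma_finite_measure (distr (sequences Q) (sequences ?K) (\<lambda>y. y \<circ> q))"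
        unfolding distr_sequences_permute[OF Q q]
        by (intro prob_space_imp_sigma_finite prob_space_PiM Q(1))
    qed (use mp mq measurable_cong_sets[OF sets_PQ(1) refl] measurable_cong_sets[OF sets_PQ(2) refl] in blast)+
    finally show "distr (distr M (sequences ?K \<Otimes>\<^sub>M sequences ?K) Z) (sequences ?K \<Otimes>\<^sub>M sequences ?K) (permute_pair j) =
        distr M (sequences ?K \<Otimes>\<^sub>M sequences ?K) Z"
      unfolding law pj by (rule sym)
  qed
  then show ?thesis
    unfolding partially_ordered_reverse_submartingale_def reverse_filtration2_def eq F_def[symmetric]
    using adapted sub antimono int[unfolded eq] by auto
qed

theorem theorem2:
  fixes M :: "'a measure"
    and S :: "(real ^ 'd) set"
    and P Q :: "(real ^ 'd) measure"
    and X Y :: "nat \<Rightarrow> 'a \<Rightarrow> real ^ 'd"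
    and \<Phi> :: "(real ^ 'd) measure \<Rightarrow> ereal"
    and \<Psi> :: "(real ^ 'd) measure \<Rightarrow> (real ^ 'd) measure \<Rightarrow> ereal"
  assumes "prob_space M"
    and "P \<in> prob_measures S" and "Q \<in> prob_measures S"
    and "iid_sequence M (borel_of S) X P"
    and "iid_sequence M (borel_of S) Y Q"
    and "independent_sequences M (borel_of S) X Y"
    and "convex_functional S \<Phi>"
    and "jointly_convex_functional S \<Psi>"
    and "\<And>t. t \<ge> 1 \<Longrightarrow>
           (\<lambda>x. \<Phi> (empirical_measure (borel_of S) t x))
             \<in> borel_measurable (PiM {1..t} (\<lambda>_. borel_of S))"
    and "\<And>t s. t \<ge> 1 \<Longrightarrow> s \<ge> 1 \<Longrightarrow>
           (\<lambda>(x, y). \<Psi> (empirical_measure (borel_of S) t x) (empirical_measure (borel_of S) s y))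
             \<in> borel_measurable (PiM {1..t} (\<lambda>_. borel_of S) \<Otimes>\<^sub>M PiM {1..s} (\<lambda>_. borel_of S))"
    and "\<And>t. t \<ge> 1 \<Longrightarrow>
           integrable_ereal M (\<lambda>\<omega>. \<Phi> (empirical_measure (borel_of S) t (\<lambda>i. X i \<omega>)))"
    and "\<And>t s. t \<ge> 1 \<Longrightarrow> s \<ge> 1 \<Longrightarrow>
           integrable_ereal M (\<lambda>\<omega>. \<Psi> (empirical_measure (borel_of S) t (\<lambda>i. X i \<omega>))
                                      (empirical_measure (borel_of S) s (\<lambda>j. Y j \<omega>)))"
  shows "reverse_submartingale M
           (exchangeable_filtration M (borel_of S) X)
           (\<lambda>t \<omega>. \<Phi> (empirical_measure (borel_of S) t (\<lambda>i. X i \<omega>)))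
       \<and> partially_ordered_reverse_submartingale M
           (\<lambda>t s. sigma (space M) (sets (exchangeable_filtration M (borel_of S) X t) \<union>
                                   sets (exchangeable_filtration M (borel_of S) Y s)))
           (\<lambda>t s \<omega>. \<Psi> (empirical_measure (borel_of S) t (\<lambda>i. X i \<omega>))
                       (empirical_measure (borel_of S) s (\<lambda>j. Y j \<omega>)))"
proof (rule conjI)
  have PQ: "prob_space P" "sets P = sets (borel_of S)" "prob_space Q" "sets Q = sets (borel_of S)"
    using assms(2,3) by (auto simp: space_prob_algebra)
  show "reverse_submartingale M
           (exchangeable_filtration M (borel_of S) X)
           (\<lambda>t \<omega>. \<Phi> (empirical_measure (borel_of S) t (\<lambda>i. X i \<omega>)))"
    using assms(1,4,7,9,11) PQ by (intro reverse_submartingale_convex_empirical[where P = P])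
  show "partially_ordered_reverse_submartingale M
           (\<lambda>t s. sigma (space M) (sets (exchangeable_filtration M (borel_of S) X t) \<union>
                                   sets (exchangeable_filtration M (borel_of S) Y s)))
           (\<lambda>t s \<omega>. \<Psi> (empirical_measure (borel_of S) t (\<lambda>i. X i \<omega>))
                       (empirical_measure (borel_of S) s (\<lambda>j. Y j \<omega>)))"
    using assms(1,4,5,6,8,10,12) PQ
    by (intro reverse_submartingale_jointly_convex_empirical[where P = P and Q = Q])
qed

end
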